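(* Let $(M,g)$ be a smooth $d$-dimensional Riemannian manifold without boundary (not necessarily compact), and let $f=f(\bar u,\cdot)$ be a smooth vector field on $M$ depending smoothly on a parameter $\bar u\in\mathbb{R}$. Let $u:\mathbb{R}_+\times M\to\mathbb{R}$ be a smooth solution of the conservation law $$\partial_t u+\nabla_g\cdot\big(f(u,\cdot)\big)=0 .$$ Then, for any smooth vector field $X$ on $M$, the function $w:=X(u):\mathbb{R}_+\times M\to\mathbb{R}$ satisfies the linear hyperbolic equation $$\partial_t w+\nabla_g\cdot\big(w\,f_u(u,\cdot)\big)=-g\big(\nabla_g u,(\mathcal{L}_Xf_u)(u,\cdot)\big)-X(\nabla_g\cdot f)(u,\cdot).$$
   Context: $\nabla_g u$ is the Riemannian gradient and $\nabla_g\cdot$ the Riemannian divergence (in coordinates $\nabla_g\cdot f=|g|^{-1/2}\partial_i(|g|^{1/2}f^i)$). The expression $\nabla_g\cdot(f(u,\cdot))$ is the divergence of the vector field $x\mapsto f(u(t,x),x)$, while $(\nabla_g\cdot f)(u,x)$ means the divergence of $f(\bar u,\cdot)$ at fixed $\bar u$, evaluated at $\bar u=u(t,x)$. $f_u=\partial f/\partial\bar u$. $X(u)=du(X)$ is the directional derivative in the space variable. $X(\nabla_g\cdot f)(u,x)$ is the derivative along $X$ of the function $x\mapsto(\nabla_g\cdot f)(\bar u,x)$ at fixed $\bar u$, evaluated at $\bar u=u(t,x)$. $\mathcal{L}_X$ is the Lie derivative: for a vector field $Y$, $\mathcal{L}_XY=[X,Y]$, i.e. $(\mathcal{L}_XY)^i=X^j\partial_jY^i-Y^j\partial_jX^i$;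 $(\mathcal{L}_Xf_u)(u,x)$ means $\mathcal{L}_X(f_u(\bar u,\cdot))(x)$ evaluated at $\bar u=u(t,x)$. *)

theory Defs
  imports "HOL-Analysis.Analysis"
begin

section \<open>Smooth functions between Euclidean spaces\<close>

text \<open>\<open>Ck_on k f S\<close> is meant for open \<open>S\<close> only.\<close>

primrec Ck_on :: "nat \<Rightarrow> ('a::euclidean_space \<Rightarrow> 'b::real_normed_vector) \<Rightarrow> 'a set \<Rightarrow> bool" where
  "Ck_on 0 f S \<longleftrightarrow> continuous_on S f"
| "Ck_on (Suc k) f S \<longleftrightarrow>
     (\<forall>x\<in>S. f differentiable (at x)) \<and> (\<forall>v. Ck_on k (\<lambda>x. frechet_derivative f (at x) v) S)"

text \<open>Smoothness on an arbitrary set, such as \<open>{0..} \<times> V\<close>, in the usual sense of local smooth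
  extendability. On open sets this is the same as being \<open>Ck_on k\<close> for all \<open>k\<close>.\<close>

definition smooth_on :: "'a::euclidean_space set \<Rightarrow> ('a \<Rightarrow> 'b::real_normed_vector) \<Rightarrow> bool" where
  "smooth_on S f \<longleftrightarrow>
     (\<forall>x\<in>S. \<exists>N F. open N \<and> x \<in> N \<and> (\<forall>k. Ck_on k F N) \<and> (\<forall>y\<in>N \<inter> S. F y = f y))"


section \<open>Smooth manifolds\<close>

text \<open>A chart is a pair of its domain and its coordinate map; the coordinate map is only relevant
  on the domain. The dimension of the manifold is \<open>CARD('n)\<close>.\<close>

type_synonym ('a, 'n) chart = "'a set \<times> ('a \<Rightarrow> real ^ 'n)"

definition cdom :: "('a, 'n::finite) chart \<Rightarrow> 'a set" where
  "cdom c = fst c"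

definition cmap :: "('a, 'n::finite) chart \<Rightarrow> 'a \<Rightarrow> real ^ 'n" where
  "cmap c = snd c"

definition cinv :: "('a, 'n::finite) chart \<Rightarrow> real ^ 'n \<Rightarrow> 'a" where
  "cinv c = inv_into (cdom c) (cmap c)"

definition is_chart :: "'a topology \<Rightarrow> ('a, 'n::finite) chart \<Rightarrow> bool" where
  "is_chart M c \<longleftrightarrow>
     openin M (cdom c) \<and> open (cmap c ` cdom c) \<and>
     homeomorphic_map (subtopology M (cdom c)) (top_of_set (cmap c ` cdom c)) (cmap c)"

definition smooth_manifold :: "'a topology \<Rightarrow> ('a, 'n::finite) chart set \<Rightarrow> bool" where
  "smooth_manifold M A \<longleftrightarrow>
     Hausdorff_space M \<and> second_countable M \<and>
     (\<forall>c\<in>A. is_chart M c) \<and> topspace M = (\<Union>c\<in>A. cdom c) \<and>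
     (\<forall>c\<in>A. \<forall>c'\<in>A. smooth_on (cmap c ` (cdom c \<inter> cdom c')) (cmap c' \<circ> cinv c))"

definition smooth_fun :: "('a, 'n::finite) chart set \<Rightarrow> 'a set \<Rightarrow> ('a \<Rightarrow> real) \<Rightarrow> bool" where
  "smooth_fun A W h \<longleftrightarrow> (\<forall>c\<in>A. smooth_on (cmap c ` (cdom c \<inter> W)) (h \<circ> cinv c))"

definition smooth_near :: "'a topology \<Rightarrow> ('a, 'n::finite) chart set \<Rightarrow> 'a \<Rightarrow> ('a \<Rightarrow> real) \<Rightarrow> bool" where
  "smooth_near M A p h \<longleftrightarrow> (\<exists>W. openin M W \<and> p \<in> W \<and> smooth_fun A W h)"

text \<open>Smoothness of a function on \<open>T \<times> M\<close>, where \<open>T \<subseteq> \<real>\<close> is a set of times or parameters.\<close>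

definition smooth_param_fun ::
    "('a, 'n::finite) chart set \<Rightarrow> real set \<Rightarrow> (real \<Rightarrow> 'a \<Rightarrow> real) \<Rightarrow> bool" where
  "smooth_param_fun A T h \<longleftrightarrow>
     (\<forall>c\<in>A. smooth_on (T \<times> cmap c ` cdom c) (\<lambda>(t, y). h t (cinv c y)))"


section \<open>Tangent vectors and vector fields\<close>

text \<open>A tangent vector at \<open>p\<close> is the operator of directional differentiation it induces on functions
  smooth near \<open>p\<close>. By convention it returns \<open>0\<close> on all other functions, so that two tangent
  vectors are equal as soon as they agree on functions smooth near \<open>p\<close>. Application of a
  tangent vector to a function \<open>h\<close> is the derivative \<open>dh(v)\<close>.\<close>

type_synonym 'a tvec = "('a \<Rightarrow> real) \<Rightarrow> real"

text \<open>The tangent vector at \<open>p\<close> with components \<open>a\<close> in the chart \<open>c\<close>, that is,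
  \<open>\<Sum>i. a\<^sub>i \<partial>\<^sub>i\<close>.\<close>

definition chart_tvec ::
    "'a topology \<Rightarrow> ('a, 'n::finite) chart set \<Rightarrow> ('a, 'n) chart \<Rightarrow> 'a \<Rightarrow> real ^ 'n \<Rightarrow> 'a tvec" where
  "chart_tvec M A c p a =
     (\<lambda>h. if smooth_near M A p h then frechet_derivative (h \<circ> cinv c) (at (cmap c p)) a else 0)"

definition chart_basis ::
    "'a topology \<Rightarrow> ('a, 'n::finite) chart set \<Rightarrow> ('a, 'n) chart \<Rightarrow> 'a \<Rightarrow> 'n \<Rightarrow> 'a tvec" where
  "chart_basis M A c p i = chart_tvec M A c p (axis i 1)"

definition tangent_space :: "'a topology \<Rightarrow> ('a, 'n::finite) chart set \<Rightarrow> 'a \<Rightarrow> 'a tvec set" where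
  "tangent_space M A p = {chart_tvec M A c p a | c a. c \<in> A \<and> p \<in> cdom c}"

definition tvec_add :: "'a tvec \<Rightarrow> 'a tvec \<Rightarrow> 'a tvec" where
  "tvec_add v w = (\<lambda>h. v h + w h)"

definition tvec_scale :: "real \<Rightarrow> 'a tvec \<Rightarrow> 'a tvec" where
  "tvec_scale r v = (\<lambda>h. r * v h)"

text \<open>The \<open>i\<close>-th component of a tangent vector in the chart \<open>c\<close> is its value on the \<open>i\<close>-th
  coordinate function.\<close>

definition component :: "('a, 'n::finite) chart \<Rightarrow> 'n \<Rightarrow> 'a tvec \<Rightarrow> real" where
  "component c i v = v (\<lambda>q. cmap c q $ i)"

definition smooth_vector_field ::
    "'a topology \<Rightarrow> ('a, 'n::finite) chart set \<Rightarrow> ('a \<Rightarrow> 'a tvec) \<Rightarrow> bool" where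
  "smooth_vector_field M A X \<longleftrightarrow>
     (\<forall>p\<in>topspace M. X p \<in> tangent_space M A p) \<and>
     (\<forall>c\<in>A. \<forall>i. smooth_on (cmap c ` cdom c) (\<lambda>y. component c i (X (cinv c y))))"

text \<open>A vector field depending on a real parameter, jointly smooth in parameter and point.\<close>

definition smooth_param_vector_field ::
    "'a topology \<Rightarrow> ('a, 'n::finite) chart set \<Rightarrow> (real \<Rightarrow> 'a \<Rightarrow> 'a tvec) \<Rightarrow> bool" where
  "smooth_param_vector_field M A f \<longleftrightarrow>
     (\<forall>s. \<forall>p\<in>topspace M. f s p \<in> tangent_space M A p) \<and>
     (\<forall>c\<in>A. \<forall>i. smooth_on (UNIV \<times> cmap c ` cdom c) (\<lambda>(s, y). component c i (f s (cinv c y))))"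

definition param_deriv :: "(real \<Rightarrow> 'a \<Rightarrow> 'a tvec) \<Rightarrow> real \<Rightarrow> 'a \<Rightarrow> 'a tvec" where
  "param_deriv f s p = (\<lambda>h. deriv (\<lambda>r. f r p h) s)"

text \<open>The Lie bracket \<open>[X, Y]\<close> as a commutator; its components in a chart are
  \<open>X\<^sup>j \<partial>\<^sub>j Y\<^sup>i - Y\<^sup>j \<partial>\<^sub>j X\<^sup>i\<close>.\<close>

definition lie_deriv ::
    "'a topology \<Rightarrow> ('a, 'n::finite) chart set \<Rightarrow> ('a \<Rightarrow> 'a tvec) \<Rightarrow> ('a \<Rightarrow> 'a tvec) \<Rightarrow> 'a \<Rightarrow> 'a tvec" where
  "lie_deriv M A X Y p =
     (\<lambda>h. if smooth_near M A p h then X p (\<lambda>q. Y q h) - Y p (\<lambda>q. X q h) else 0)"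


section \<open>Riemannian metrics, gradient and divergence\<close>

type_synonym 'a metric = "'a \<Rightarrow> 'a tvec \<Rightarrow> 'a tvec \<Rightarrow> real"

definition gram ::
    "'a topology \<Rightarrow> ('a, 'n::finite) chart set \<Rightarrow> 'a metric \<Rightarrow> ('a, 'n) chart \<Rightarrow> 'a \<Rightarrow> real ^ 'n ^ 'n" where
  "gram M A g c p = (\<chi> i j. g p (chart_basis M A c p i) (chart_basis M A c p j))"

text \<open>Linearity in the second argument follows from symmetry.\<close>

definition riemannian_metric :: "'a topology \<Rightarrow> ('a, 'n::finite) chart set \<Rightarrow> 'a metric \<Rightarrow> bool" where
  "riemannian_metric M A g \<longleftrightarrow>
     (\<forall>p\<in>topspace M.
        (\<forall>v\<in>tangent_space M A p. \<forall>w\<in>tangent_space M A p. g p v w = g p w v) \<and>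
        (\<forall>v\<in>tangent_space M A p. \<forall>v'\<in>tangent_space M A p. \<forall>w\<in>tangent_space M A p.
           g p (tvec_add v v') w = g p v w + g p v' w) \<and>
        (\<forall>r. \<forall>v\<in>tangent_space M A p. \<forall>w\<in>tangent_space M A p.
           g p (tvec_scale r v) w = r * g p v w) \<and>
        (\<forall>v\<in>tangent_space M A p. v \<noteq> (\<lambda>h. 0) \<longrightarrow> g p v v > 0)) \<and>
     (\<forall>c\<in>A. \<forall>i j. smooth_on (cmap c ` cdom c) (\<lambda>y. gram M A g c (cinv c y) $ i $ j))"

definition grad ::
    "'a topology \<Rightarrow> ('a, 'n::finite) chart set \<Rightarrow> 'a metric \<Rightarrow> ('a \<Rightarrow> real) \<Rightarrow> 'a \<Rightarrow> 'a tvec" where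
  "grad M A g h p =
     (THE v. v \<in> tangent_space M A p \<and> (\<forall>w\<in>tangent_space M A p. g p v w = w h))"

text \<open>The coordinate expression \<open>\<bar>g\<bar>\<^sup>-\<^sup>1\<^sup>/\<^sup>2 \<partial>\<^sub>i (\<bar>g\<bar>\<^sup>1\<^sup>/\<^sup>2 X\<^sup>i)\<close> in the chart \<open>c\<close>.\<close>

definition chart_divergence ::
    "'a topology \<Rightarrow> ('a, 'n::finite) chart set \<Rightarrow> 'a metric \<Rightarrow> ('a, 'n) chart \<Rightarrow> ('a \<Rightarrow> 'a tvec) \<Rightarrow> 'a \<Rightarrow> real" where
  "chart_divergence M A g c X p =
     (\<Sum>i\<in>UNIV. chart_basis M A c p i (\<lambda>q. sqrt (det (gram M A g c q)) * component c i (X q)))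
       / sqrt (det (gram M A g c p))"

text \<open>The divergence is the common value of these expressions over all charts around \<open>p\<close>.\<close>

definition divergence ::
    "'a topology \<Rightarrow> ('a, 'n::finite) chart set \<Rightarrow> 'a metric \<Rightarrow> ('a \<Rightarrow> 'a tvec) \<Rightarrow> 'a \<Rightarrow> real" where
  "divergence M A g X p = (THE r. \<forall>c\<in>A. p \<in> cdom c \<longrightarrow> chart_divergence M A g c X p = r)"


section \<open>Time derivative on \<open>[0, \<infinity>) \<times> M\<close>\<close>

text \<open>At \<open>t = 0\<close> this is the one-sided derivative.\<close>

definition time_deriv :: "(real \<Rightarrow> 'a \<Rightarrow> real) \<Rightarrow> real \<Rightarrow> 'a \<Rightarrow> real" where
  "time_deriv u t p = vector_derivative (\<lambda>s. u s p) (at t within {0..})"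

end

theory Submission
  imports Defs
begin

text \<open>In a chart, the divergence of the composite field \<open>f(u, \<cdot>)\<close> is
  \<open>(\<nabla>\<cdot>f)(u, x) + f\<^sub>u\<^sup>i \<partial>\<^sub>i u\<close>. Differentiating the conservation law along \<open>X\<close> at a fixed time therefore
  gives the term \<open>X(\<nabla>\<cdot>f)\<close>, the terms of \<open>\<nabla>\<cdot>(w f\<^sub>u)\<close> in which \<open>w\<close> is not differentiated, and
  \<open>X(Y(u))\<close>, where \<open>Y\<close> is the field \<open>f\<^sub>u\<close> with its parameter frozen; \<open>X(Y(u))\<close> differs from the
  remaining term \<open>Y(w) = Y(X(u))\<close> by the
  bracket \<open>[X, Y]\<close> applied to \<open>u\<close>. The derivatives \<open>\<partial>\<^sub>t\<close> and \<open>X\<close> commute, also at \<open>t = 0\<close>, because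
  \<open>u\<close> extends smoothly to negative times near each point. Since the divergence is defined as the
  common value over all charts, its independence of the chart is part of the claim; it
  rests on Jacobi's formula for the derivative of a determinant.\<close>

section \<open>Smooth functions on open sets\<close>

text \<open>Two conventions shape the work. A tangent vector returns \<open>0\<close> on functions
  that are not smooth near its base point, so before it is applied to a coordinate function, to some
  \<open>X q h\<close> or to a divergence, that function has to be shown smooth there. And
  \<open>grad\<close> and \<open>divergence\<close> are definite descriptions, usable only after
  existence and uniqueness are proved: for the gradient by inverting the Gram matrix, for the
  divergence by comparing charts. The local extension \<open>F\<close> of \<open>u\<close> across
  \<open>t = 0\<close> need not solve the conservation law at negative times. This does no harm: the
  law is differentiated in space only, at the one time \<open>t\<close>, and the time derivative of
  \<open>w\<close> is read off \<open>F\<close> on an open set around the point. What remains is an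
  identity between derivatives at one point of Euclidean space, in which \<open>X\<close> appears
  through the constant vector of its components at that point; the variation of \<open>X\<close>
  enters through the derivative of \<open>w\<close> alone.\<close>

abbreviation D :: "('a::euclidean_space \<Rightarrow> 'b::real_normed_vector) \<Rightarrow> 'a \<Rightarrow> 'a \<Rightarrow> 'b" where
  "D f x \<equiv> frechet_derivative f (at x)"

lemma D_eqI: "(f has_derivative f') (at x) \<Longrightarrow> D f x v = f' v"
  by (metis frechet_derivative_at)

lemma has_derivative_D: "f differentiable (at x) \<Longrightarrow> (f has_derivative D f x) (at x)"
  using frechet_derivative_works by blast

lemma linear_D: "f differentiable (at x) \<Longrightarrow> linear (D f x)"
  using linear_frechet_derivative by blast

lemma D_cong:
  assumes "open S" "x \<in> S" "\<And>y. y \<in> S \<Longrightarrow> f y = g y"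
  shows "D f x = D g x"
proof -
  have "(f has_derivative f') (at x) \<longleftrightarrow> (g has_derivative f') (at x)" for f'
    using has_derivative_transform_within_open[OF _ assms(1,2)] assms(3) by metis
  then show ?thesis unfolding frechet_derivative_def by simp
qed

lemma differentiable_cong_open:
  assumes "open S" "x \<in> S" "\<And>y. y \<in> S \<Longrightarrow> f y = g y"
  shows "f differentiable (at x) \<longleftrightarrow> g differentiable (at x)"
  using has_derivative_transform_within_open[OF _ assms(1,2)] assms(3)
  unfolding differentiable_def by metis

lemma D_compose:
  assumes "g differentiable (at (f x))" "f differentiable (at x)"
  shows "D (\<lambda>x. g (f x)) x v = D g (f x) (D f x v)"
  using frechet_derivative_compose[OF assms(2,1)] by (simp add: o_def)

lemma D_const: "D (\<lambda>x. c) x v = 0"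
  by simp

lemma D_add:
  "f differentiable (at x) \<Longrightarrow> g differentiable (at x) \<Longrightarrow>
    D (\<lambda>x. f x + g x) x v = D f x v + D g x v"
  by (rule D_eqI) (auto intro!: derivative_intros has_derivative_D)

lemma D_sum:
  "(\<And>i. i \<in> I \<Longrightarrow> f i differentiable (at x)) \<Longrightarrow>
    D (\<lambda>x. \<Sum>i\<in>I. f i x) x v = (\<Sum>i\<in>I. D (f i) x v)"
  by (rule D_eqI) (auto intro!: derivative_intros has_derivative_D)

lemma D_mult:
  fixes f g :: "'a::euclidean_space \<Rightarrow> real"
  shows "f differentiable (at x) \<Longrightarrow> g differentiable (at x) \<Longrightarrow>
    D (\<lambda>x. f x * g x) x v = D f x v * g x + f x * D g x v"
  by (subst D_eqI[OF has_derivative_mult[OF has_derivative_D has_derivative_D]]) auto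

lemma D_bounded_linear:
  assumes "bounded_linear L" "f differentiable (at x)"
  shows "D (\<lambda>x. L (f x)) x v = L (D f x v)"
  by (rule D_eqI[OF bounded_linear.has_derivative[OF assms(1) has_derivative_D[OF assms(2)]]])

lemma differentiable_bounded_linear:
  "bounded_linear L \<Longrightarrow> f differentiable (at x) \<Longrightarrow> (\<lambda>x. L (f x)) differentiable (at x)"
  unfolding differentiable_def by (blast intro: bounded_linear.has_derivative)

lemma D_Pair:
  "f differentiable (at x) \<Longrightarrow> g differentiable (at x) \<Longrightarrow>
    D (\<lambda>x. (f x, g x)) x v = (D f x v, D g x v)"
  by (rule D_eqI) (auto intro!: derivative_intros has_derivative_D)

lemma differentiable_Pair:
  "f differentiable (at x) \<Longrightarrow> g differentiable (at x) \<Longrightarrow> (\<lambda>x. (f x, g x)) differentiable (at x)"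
  unfolding differentiable_def by (blast intro: has_derivative_Pair)


section \<open>Smoothness of all orders and its closure properties\<close>

definition Cinf :: "'a::euclidean_space set \<Rightarrow> ('a \<Rightarrow> 'b::real_normed_vector) \<Rightarrow> bool" where
  "Cinf S f \<longleftrightarrow> (\<forall>k. Ck_on k f S)"

text \<open>At a positive level the continuity of the function itself is not part of
  \<open>Ck_on\<close>. At the bottom of the induction it is supplied by differentiability; above
  that the claim passes to the directional derivatives.\<close>

lemma Ck_on_SucD: "Ck_on (Suc k) f S \<Longrightarrow> Ck_on k f S"
proof (induction k arbitrary: f)
  case 0
  then show ?case
    by (auto intro!: continuous_at_imp_continuous_on differentiable_imp_continuous_within)
next
  case (Suc k)
  then show ?case by (metis Ck_on.simps(2))
qed

lemma Cinf_differentiable: "Cinf S f \<Longrightarrow> x \<in> S \<Longrightarrow> f differentiable (at x)"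
  unfolding Cinf_def by (meson Ck_on.simps(2))

lemma Cinf_D: "Cinf S f \<Longrightarrow> Cinf S (\<lambda>x. D f x v)"
  unfolding Cinf_def by (metis Ck_on.simps(2))

lemma Cinf_continuous_on: "Cinf S f \<Longrightarrow> continuous_on S f"
  unfolding Cinf_def by (metis Ck_on.simps(1))

lemma Ck_on_subset: "Ck_on k f S \<Longrightarrow> T \<subseteq> S \<Longrightarrow> Ck_on k f T"
  by (induction k arbitrary: f) (auto intro: continuous_on_subset)

lemma Cinf_subset: "Cinf S f \<Longrightarrow> T \<subseteq> S \<Longrightarrow> Cinf T f"
  unfolding Cinf_def using Ck_on_subset by blast

lemma Ck_on_cong:
  assumes "open S" "\<And>x. x \<in> S \<Longrightarrow> f x = g x" "Ck_on k f S"
  shows "Ck_on k g S"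
  using assms(2,3)
proof (induction k arbitrary: f g)
  case 0
  then show ?case by (metis Ck_on.simps(1) continuous_on_cong)
next
  case (Suc k)
  have "g differentiable (at x)" if "x \<in> S" for x
    using differentiable_cong_open[OF assms(1) that, of f g] Suc.prems that by auto
  moreover have "Ck_on k (\<lambda>x. D g x v) S" for v
  proof (rule Suc.IH)
    show "Ck_on k (\<lambda>x. D f x v) S" using Suc.prems(2) by simp
    show "D f x v = D g x v" if "x \<in> S" for x
      using D_cong[OF assms(1) that, of f g] Suc.prems(1) by simp
  qed
  ultimately show ?case by simp
qed

lemma Cinf_cong:
  "open S \<Longrightarrow> (\<And>x. x \<in> S \<Longrightarrow> f x = g x) \<Longrightarrow> Cinf S f \<Longrightarrow> Cinf S g"
  unfolding Cinf_def using Ck_on_cong by blast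

lemma Ck_on_local:
  assumes "\<And>x. x \<in> S \<Longrightarrow> \<exists>N. open N \<and> x \<in> N \<and> Ck_on k f N"
  shows "Ck_on k f S"
  using assms
proof (induction k arbitrary: f)
  case 0
  have "continuous (at x) f" if "x \<in> S" for x
    using 0[OF that] continuous_on_eq_continuous_at by auto
  then show ?case by (simp add: continuous_at_imp_continuous_on)
next
  case (Suc k)
  have "f differentiable (at x)" if "x \<in> S" for x
    using Suc.prems[OF that] by auto
  moreover have "Ck_on k (\<lambda>x. D f x v) S" for v
  proof (rule Suc.IH)
    show "\<exists>N. open N \<and> x \<in> N \<and> Ck_on k (\<lambda>x. D f x v) N" if "x \<in> S" for x
      using Suc.prems[OF that] by auto
  qed
  ultimately show ?case by simp
qed

text \<open>Around a point of an open set the local extension agrees with \<open>f\<close> on a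
  whole neighbourhood, and \<open>Ck_on\<close> can be checked locally.\<close>

lemma smooth_on_imp_Cinf:
  assumes "open S" "smooth_on S f"
  shows "Cinf S f"
  unfolding Cinf_def
proof (intro allI Ck_on_local)
  fix k x assume x: "x \<in> S"
  then obtain N F where N: "open N" "x \<in> N" "\<And>k. Ck_on k F N" "\<And>y. y \<in> N \<inter> S \<Longrightarrow> F y = f y"
    using assms(2) unfolding smooth_on_def by metis
  have "Ck_on k f (N \<inter> S)"
    by (rule Ck_on_cong[of _ F]) (use N assms(1) Ck_on_subset[OF N(3)] in auto)
  then show "\<exists>N. open N \<and> x \<in> N \<and> Ck_on k f N"
    using N x assms(1) by (metis IntI open_Int)
qed

lemma Cinf_imp_smooth_on: "open S \<Longrightarrow> Cinf S f \<Longrightarrow> smooth_on S f"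
  unfolding smooth_on_def Cinf_def by blast

lemma Ck_on_bounded_linear:
  "bounded_linear L \<Longrightarrow> Ck_on k f S \<Longrightarrow> Ck_on k (\<lambda>x. L (f x)) S" if "open S"
proof (induction k arbitrary: f)
  case 0
  then show ?case using linear_continuous_on_compose
    by (simp add: bounded_linear.continuous_on)
next
  case (Suc k)
  have "Ck_on k (\<lambda>x. D (\<lambda>x. L (f x)) x v) S" for v
    by (rule Ck_on_cong[OF that _ Suc.IH[OF Suc.prems(1)], of "\<lambda>x. D f x v"])
      (use Suc.prems in \<open>auto simp: D_bounded_linear\<close>)
  then show ?case using Suc.prems by (simp add: differentiable_bounded_linear)
qed

lemma Ck_on_add:
  "Ck_on k f S \<Longrightarrow> Ck_on k g S \<Longrightarrow> Ck_on k (\<lambda>x. f x + g x) S" if "open S"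
proof (induction k arbitrary: f g)
  case 0
  then show ?case by (simp add: continuous_on_add)
next
  case (Suc k)
  have "Ck_on k (\<lambda>x. D (\<lambda>x. f x + g x) x v) S" for v
    by (rule Ck_on_cong[OF that _ Suc.IH, of "\<lambda>x. D f x v" "\<lambda>x. D g x v"])
      (use Suc.prems in \<open>auto simp: D_add\<close>)
  then show ?case using Suc.prems by auto
qed

lemma Ck_on_mult:
  "Ck_on k f S \<Longrightarrow> Ck_on k g S \<Longrightarrow> Ck_on k (\<lambda>x. f x * g x) S" if "open S"
  for f g :: "'a::euclidean_space \<Rightarrow> real"
proof (induction k arbitrary: f g)
  case 0
  then show ?case by (simp add: continuous_on_mult)
next
  case (Suc k)
  \<comment> \<open>The product rule pairs a derivative, known at level \<open>k\<close>, with an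
    undifferentiated factor, known at level \<open>Suc k\<close>. The latter is lowered so that the
    induction hypothesis covers both.\<close>
  have f: "Ck_on k f S" "Ck_on k g S" using Suc.prems Ck_on_SucD by blast+
  have "Ck_on k (\<lambda>x. D f x v * g x + f x * D g x v) S" for v
    using Ck_on_add[OF that Suc.IH Suc.IH] f Suc.prems by simp
  then have "Ck_on k (\<lambda>x. D (\<lambda>x. f x * g x) x v) S" for v
    by (rule Ck_on_cong[OF that, rotated]) (use Suc.prems in \<open>auto simp: D_mult\<close>)
  then show ?case using Suc.prems by auto
qed

lemma Ck_on_const: "Ck_on k (\<lambda>x. c) S"
  by (induction k arbitrary: c) (auto simp: D_const)

lemma Ck_on_sum:
  "(\<And>i. i \<in> I \<Longrightarrow> Ck_on k (f i) S) \<Longrightarrow> Ck_on k (\<lambda>x. \<Sum>i\<in>I. f i x) S" if "open S"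
  by (induction I rule: infinite_finite_induct) (auto intro!: Ck_on_const Ck_on_add that)

lemma D_sum_Basis:
  fixes f :: "'a::euclidean_space \<Rightarrow> real"
  assumes "f differentiable (at x)"
  shows "D f x v = (\<Sum>b\<in>Basis. (v \<bullet> b) * D f x b)"
proof -
  have "D f x v = D f x (\<Sum>b\<in>Basis. (v \<bullet> b) *\<^sub>R b)" by (simp add: euclidean_representation)
  also have "\<dots> = (\<Sum>b\<in>Basis. (v \<bullet> b) * D f x b)"
    using linear_D[OF assms] by (simp add: linear_sum linear_cmul)
  finally show ?thesis .
qed

text \<open>The chain rule applies the derivative of \<open>g\<close> to the direction
  \<open>D f x v\<close>, which varies with \<open>x\<close>, while \<open>Ck_on\<close> controls
  derivatives in fixed directions only. Expanding the direction in \<open>Basis\<close> gives a sum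
  of products that the induction hypothesis covers.\<close>

lemma Ck_on_compose:
  fixes g :: "'b::euclidean_space \<Rightarrow> real" and f :: "'a::euclidean_space \<Rightarrow> 'b"
  assumes "open S" "f ` S \<subseteq> T"
  shows "Ck_on k f S \<Longrightarrow> Ck_on k g T \<Longrightarrow> Ck_on k (\<lambda>x. g (f x)) S"
proof (induction k arbitrary: g)
  case 0
  then show ?case using assms by (simp add: continuous_on_compose2)
next
  case (Suc k)
  have f: "Ck_on k f S" using Suc.prems Ck_on_SucD by blast
  have df: "f differentiable (at x)" and dg: "g differentiable (at (f x))" if "x \<in> S" for x
    using Suc.prems assms that by auto
  have "Ck_on k (\<lambda>x. \<Sum>b\<in>Basis. (D f x v \<bullet> b) * D g (f x) b) S" for v
    by (intro Ck_on_sum Ck_on_mult assms Suc.IH f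
        Ck_on_bounded_linear[OF _ bounded_linear_inner_left]) (use Suc.prems in auto)
  then have "Ck_on k (\<lambda>x. D (\<lambda>x. g (f x)) x v) S" for v
    by (rule Ck_on_cong[OF assms(1), rotated])
      (simp add: D_compose[OF dg df] D_sum_Basis[OF dg, symmetric])
  moreover have "(\<lambda>x. g (f x)) differentiable (at x)" if "x \<in> S" for x
    using differentiable_chain_at[OF df[OF that] dg[OF that]] by (simp add: o_def)
  ultimately show ?case by simp
qed

lemma Ck_on_Pair:
  "Ck_on k f S \<Longrightarrow> Ck_on k g S \<Longrightarrow> Ck_on k (\<lambda>x. (f x, g x)) S" if "open S"
proof (induction k arbitrary: f g)
  case 0
  then show ?case by (simp add: continuous_on_Pair)
next
  case (Suc k)
  have "Ck_on k (\<lambda>x. D (\<lambda>x. (f x, g x)) x v) S" for v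
    by (rule Ck_on_cong[OF that _ Suc.IH, of "\<lambda>x. D f x v" "\<lambda>x. D g x v"])
      (use Suc.prems in \<open>auto simp: D_Pair\<close>)
  then show ?case using Suc.prems differentiable_Pair by auto
qed

lemma Ck_on_id: "Ck_on k (\<lambda>x. x) S"
  by (cases k) (auto simp: Ck_on_const)

text \<open>The derivative is a polynomial in \<open>inverse\<close> itself, so the induction
  hypothesis for the same function closes the step.\<close>

lemma Ck_on_inverse: "Ck_on k (inverse :: real \<Rightarrow> real) (- {0})"
proof (induction k)
  case 0
  then show ?case by (auto intro!: continuous_intros)
next
  case (Suc k)
  have der: "((inverse :: real \<Rightarrow> real) has_derivative (\<lambda>h. - (inverse x * h * inverse x))) (at x)"
    if "x \<in> - {0}" for x :: real
    using has_derivative_inverse' that by auto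
  have o: "open (- {0::real})" by auto
  have "Ck_on k (\<lambda>x. (- v) * (inverse x * inverse x)) (- {0::real})" for v
    by (intro Ck_on_mult[OF o] Ck_on_const Suc)
  then have "Ck_on k (\<lambda>x. D inverse x v) (- {0::real})" for v
    by (rule Ck_on_cong[OF o, rotated]) (simp add: D_eqI[OF der])
  then show ?case using der by (auto simp: differentiable_def)
qed

text \<open>The formula \<open>(sqrt x)' = sqrt x / (2 x)\<close> is valid for all \<open>x \<noteq> 0\<close> because \<open>sqrt\<close> is an
  odd function in Isabelle.\<close>

lemma has_derivative_sqrt_nonzero:
  assumes "x \<noteq> 0"
  shows "(sqrt has_derivative (\<lambda>h. h / 2 * (sqrt x * inverse x))) (at x)"
proof -
  have "sqrt x * inverse x = (if x > 0 then inverse (sqrt x) else - inverse (sqrt x))"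
  proof -
    have "sqrt x * sqrt x = \<bar>x\<bar>" by (rule real_sqrt_mult_self)
    then show ?thesis using assms by (auto simp: field_simps abs_if split: if_splits)
  qed
  then have "(sqrt has_real_derivative (sqrt x * inverse x / 2)) (at x)"
    using assms by (intro DERIV_real_sqrt_generic) auto
  moreover have "(*) (sqrt x * inverse x / 2) = (\<lambda>h. h / 2 * (sqrt x * inverse x))"
    by (simp add: fun_eq_iff)
  ultimately show ?thesis by (simp add: has_field_derivative_def)
qed

text \<open>The derivative is again a product of \<open>sqrt\<close> and \<open>inverse\<close>. As
  the domain includes negative numbers, a Gram determinant only has to be shown nonzero
  later.\<close>

lemma Ck_on_sqrt: "Ck_on k sqrt (- {0})"
proof (induction k)
  case 0
  then show ?case by (auto intro!: continuous_intros)
next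
  case (Suc k)
  have o: "open (- {0::real})" by auto
  have "Ck_on k (\<lambda>x. (v/2) * (sqrt x * inverse x)) (- {0::real})" for v
    by (intro Ck_on_mult[OF o] Ck_on_const Suc Ck_on_inverse)
  then have "Ck_on k (\<lambda>x. D sqrt x v) (- {0::real})" for v
    by (rule Ck_on_cong[OF o, rotated]) (simp add: D_eqI[OF has_derivative_sqrt_nonzero])
  then show ?case using has_derivative_sqrt_nonzero by (auto simp: differentiable_def)
qed

context
  fixes S :: "'a::euclidean_space set"
  assumes S: "open S"
begin

lemma Cinf_const: "Cinf S (\<lambda>x. c)"
  unfolding Cinf_def using Ck_on_const by blast

lemma Cinf_id: "Cinf S (\<lambda>x. x)"
  unfolding Cinf_def using Ck_on_id by blast

lemma Cinf_add: "Cinf S f \<Longrightarrow> Cinf S g \<Longrightarrow> Cinf S (\<lambda>x. f x + g x)"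
  unfolding Cinf_def using Ck_on_add[OF S] by blast

lemma Cinf_sum: "(\<And>i. i \<in> I \<Longrightarrow> Cinf S (f i)) \<Longrightarrow> Cinf S (\<lambda>x. \<Sum>i\<in>I. f i x)"
  by (simp add: Cinf_def Ck_on_sum[OF S])

lemma Cinf_Pair: "Cinf S f \<Longrightarrow> Cinf S g \<Longrightarrow> Cinf S (\<lambda>x. (f x, g x))"
  unfolding Cinf_def using Ck_on_Pair[OF S] by blast

lemma Cinf_bounded_linear: "bounded_linear L \<Longrightarrow> Cinf S f \<Longrightarrow> Cinf S (\<lambda>x. L (f x))"
  unfolding Cinf_def using Ck_on_bounded_linear[OF S] by blast

lemma Cinf_mult:
  "Cinf S f \<Longrightarrow> Cinf S g \<Longrightarrow> Cinf S (\<lambda>x. f x * g x)" for f g :: "'a \<Rightarrow> real"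
  unfolding Cinf_def using Ck_on_mult[OF S] by blast

lemma Cinf_compose:
  fixes g :: "'b::euclidean_space \<Rightarrow> real"
  shows "Cinf T g \<Longrightarrow> Cinf S f \<Longrightarrow> f ` S \<subseteq> T \<Longrightarrow> Cinf S (\<lambda>x. g (f x))"
  unfolding Cinf_def using Ck_on_compose[OF S] by blast

lemma Cinf_inverse:
  "Cinf S f \<Longrightarrow> (\<And>x. x \<in> S \<Longrightarrow> f x \<noteq> 0) \<Longrightarrow> Cinf S (\<lambda>x. inverse (f x))" for f :: "'a \<Rightarrow> real"
  by (rule Cinf_compose[of "- {0}"]) (auto simp: Cinf_def Ck_on_inverse)

lemma Cinf_sqrt:
  "Cinf S f \<Longrightarrow> (\<And>x. x \<in> S \<Longrightarrow> f x \<noteq> 0) \<Longrightarrow> Cinf S (\<lambda>x. sqrt (f x))"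
  by (rule Cinf_compose[of "- {0}"]) (auto simp: Cinf_def Ck_on_sqrt)

lemma Cinf_divide:
  "Cinf S f \<Longrightarrow> Cinf S g \<Longrightarrow> (\<And>x. x \<in> S \<Longrightarrow> g x \<noteq> 0) \<Longrightarrow> Cinf S (\<lambda>x. f x / g x)"
  for f g :: "'a \<Rightarrow> real"
  unfolding divide_inverse by (intro Cinf_mult Cinf_inverse)

lemma Cinf_prod:
  "(\<And>i. i \<in> I \<Longrightarrow> Cinf S (f i)) \<Longrightarrow> Cinf S (\<lambda>x. \<Prod>i\<in>I. f i x)" for f :: "'i \<Rightarrow> 'a \<Rightarrow> real"
  by (induction I rule: infinite_finite_induct) (auto intro!: Cinf_const Cinf_mult)

lemma Cinf_det:
  fixes B :: "'a \<Rightarrow> real ^ 'n ^ 'n"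
  shows "(\<And>i j. Cinf S (\<lambda>x. B x $ i $ j)) \<Longrightarrow> Cinf S (\<lambda>x. det (B x))"
  unfolding det_def by (intro Cinf_sum Cinf_mult Cinf_prod Cinf_const)

end

text \<open>Both orders of differentiation are values of the same second difference quotient at points
  near \<open>x\<close>, by applying the mean value theorem twice.\<close>

lemma second_difference_mean_value:
  fixes h :: "'a::euclidean_space \<Rightarrow> real"
  assumes "0 < t" "\<And>r s. r \<in> {0..t} \<Longrightarrow> s \<in> {0..t} \<Longrightarrow> x + r *\<^sub>R a + s *\<^sub>R b \<in> S" "Cinf S h"
  obtains r s where "r \<in> {0..t}" "s \<in> {0..t}"
    "h (x + t *\<^sub>R a + t *\<^sub>R b) - h (x + t *\<^sub>R a) - h (x + t *\<^sub>R b) + h x =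
       t * t * D (\<lambda>z. D h z a) (x + r *\<^sub>R a + s *\<^sub>R b) b"
proof -
  have da: "((\<lambda>r. h (x + r *\<^sub>R a + s *\<^sub>R b)) has_real_derivative D h (x + r *\<^sub>R a + s *\<^sub>R b) a) (at r)"
    if "r \<in> {0..t}" "s \<in> {0..t}" for r s
  proof -
    have hd: "h differentiable (at (x + r *\<^sub>R a + s *\<^sub>R b))"
      using Cinf_differentiable assms that by blast
    have "((\<lambda>r. h (x + r *\<^sub>R a + s *\<^sub>R b)) has_derivative (\<lambda>k. D h (x + r *\<^sub>R a + s *\<^sub>R b) (k *\<^sub>R a))) (at r)"
      by (rule has_derivative_compose[where f = "\<lambda>r. x + r *\<^sub>R a + s *\<^sub>R b" and x = r, OF _ has_derivative_D[OF hd]])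
        (auto intro!: derivative_eq_intros)
    then show ?thesis
      using linear_D[OF hd] by (simp add: has_field_derivative_def linear_cmul mult_commute_abs)
  qed
  have db: "((\<lambda>s. D h (x + r *\<^sub>R a + s *\<^sub>R b) a) has_real_derivative
      D (\<lambda>z. D h z a) (x + r *\<^sub>R a + s *\<^sub>R b) b) (at s)"
    if "r \<in> {0..t}" "s \<in> {0..t}" for r s
  proof -
    have hd: "(\<lambda>z. D h z a) differentiable (at (x + r *\<^sub>R a + s *\<^sub>R b))"
      using Cinf_differentiable[OF Cinf_D] assms that by blast
    have "((\<lambda>s. D h (x + r *\<^sub>R a + s *\<^sub>R b) a) has_derivative
        (\<lambda>k. D (\<lambda>z. D h z a) (x + r *\<^sub>R a + s *\<^sub>R b) (k *\<^sub>R b))) (at s)"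
      by (rule has_derivative_compose[where f = "\<lambda>s. x + r *\<^sub>R a + s *\<^sub>R b" and x = s, OF _ has_derivative_D[OF hd]])
        (auto intro!: derivative_eq_intros)
    then show ?thesis
      using linear_D[OF hd] by (simp add: has_field_derivative_def linear_cmul mult_commute_abs)
  qed
  \<comment> \<open>The mean value theorem along \<open>a\<close> is applied to the increment of
    \<open>h\<close> in the direction \<open>t *\<^sub>R b\<close>. The derivative of this increment
    is itself an increment, to which the theorem applies along \<open>b\<close>.\<close>
  have dg: "((\<lambda>r. h (x + r *\<^sub>R a + t *\<^sub>R b) - h (x + r *\<^sub>R a)) has_real_derivative
      (D h (x + r *\<^sub>R a + t *\<^sub>R b) a - D h (x + r *\<^sub>R a) a)) (at r)" if "0 \<le> r" "r \<le> t" for r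
    using DERIV_diff[OF da[of r t] da[of r 0]] that assms(1) by simp
  from MVT2[OF assms(1) dg] obtain r where r: "0 < r" "r < t"
    "h (x + t *\<^sub>R a + t *\<^sub>R b) - h (x + t *\<^sub>R a) - (h (x + t *\<^sub>R b) - h x) =
      t * (D h (x + r *\<^sub>R a + t *\<^sub>R b) a - D h (x + r *\<^sub>R a) a)"
    by auto
  from MVT2[OF assms(1) db, of r] r obtain s where s: "0 < s" "s < t"
    "D h (x + r *\<^sub>R a + t *\<^sub>R b) a - D h (x + r *\<^sub>R a) a =
      t * D (\<lambda>z. D h z a) (x + r *\<^sub>R a + s *\<^sub>R b) b"
    by auto
  show thesis
    by (rule that[of r s]) (use r s in auto)
qed

text \<open>Exchanging \<open>a\<close> and \<open>b\<close> leaves the second difference unchanged,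
  so for each small \<open>t\<close> there are points near \<open>x\<close> at which the two mixed
  derivatives agree. These points tend to \<open>x\<close> with \<open>t\<close>, and both
  derivatives are continuous.\<close>

lemma symmetric_D:
  fixes h :: "'a::euclidean_space \<Rightarrow> real"
  assumes S: "open S" "x \<in> S" and h: "Cinf S h"
  shows "D (\<lambda>z. D h z a) x b = D (\<lambda>z. D h z b) x a"
proof -
  let ?P = "\<lambda>z. D (\<lambda>z. D h z a) z b" and ?Q = "\<lambda>z. D (\<lambda>z. D h z b) z a"
  have cont: "isCont ?P x" "isCont ?Q x"
    using Cinf_continuous_on[OF Cinf_D[OF Cinf_D[OF h]]] S continuous_on_eq_continuous_at by blast+
  obtain e where e: "e > 0" "ball x e \<subseteq> S"
    using S open_contains_ball by blast
  \<comment> \<open>With this \<open>c\<close> the parallelogram spanned at \<open>x\<close> by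
    \<open>c *\<^sub>R a\<close> and \<open>c *\<^sub>R b\<close> stays within \<open>e / 2\<close>
    of \<open>x\<close>. The summand \<open>1\<close> keeps the denominator positive when both
    vectors vanish.\<close>
  define c where "c = e / (2 * (norm a + norm b + 1))"
  have pos: "norm a + norm b + 1 > 0" by (smt (verit) norm_ge_zero)
  have c: "c > 0" using e pos by (simp add: c_def)
  have near: "norm (r *\<^sub>R a + s *\<^sub>R b) \<le> t * (norm a + norm b + 1)"
    if "r \<in> {0..t}" "s \<in> {0..t}" for r s t
  proof -
    have "norm (r *\<^sub>R a + s *\<^sub>R b) \<le> r * norm a + s * norm b"
      using norm_triangle_ineq[of "r *\<^sub>R a" "s *\<^sub>R b"] that by simp
    also have "\<dots> \<le> t * norm a + t * norm b"
      using that by (intro add_mono mult_right_mono) auto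
    finally show ?thesis using that by (simp add: algebra_simps)
  qed
  have inS: "x + r *\<^sub>R a + s *\<^sub>R b \<in> S" if "t \<le> c" "r \<in> {0..t}" "s \<in> {0..t}" for r s t
  proof -
    have "norm (r *\<^sub>R a + s *\<^sub>R b) \<le> c * (norm a + norm b + 1)"
      using near[OF that(2,3)] mult_right_mono[OF that(1), of "norm a + norm b + 1"] pos by linarith
    also have "\<dots> = e / 2"
    proof -
      have "e / (2 * r) * r = e / 2" if "r > 0" for r :: real using that by simp
      then show ?thesis unfolding c_def using pos by blast
    qed
    also have "\<dots> < e" using e by simp
    finally have "x + (r *\<^sub>R a + s *\<^sub>R b) \<in> ball x e"
      by (metis add_diff_cancel_left' dist_norm dist_commute mem_ball)
    then show ?thesis using e by (auto simp: add.assoc)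
  qed
  have ex: "\<exists>p q. ?P p = ?Q q \<and> norm (p - x) \<le> t * (norm a + norm b + 1)
      \<and> norm (q - x) \<le> t * (norm a + norm b + 1)" if t: "0 < t" "t \<le> c" for t
  proof -
    obtain r s where 1: "r \<in> {0..t}" "s \<in> {0..t}"
      "h (x + t *\<^sub>R a + t *\<^sub>R b) - h (x + t *\<^sub>R a) - h (x + t *\<^sub>R b) + h x =
        t * t * ?P (x + r *\<^sub>R a + s *\<^sub>R b)"
      by (rule second_difference_mean_value[OF t(1) inS[OF t(2)] h]) (assumption | rule that)+
    have inS': "x + r *\<^sub>R b + s *\<^sub>R a \<in> S" if "r \<in> {0..t}" "s \<in> {0..t}" for r s
      using inS[OF t(2) that(2,1)] by (simp add: algebra_simps)
    obtain r' s' where 2: "r' \<in> {0..t}" "s' \<in> {0..t}"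
      "h (x + t *\<^sub>R b + t *\<^sub>R a) - h (x + t *\<^sub>R b) - h (x + t *\<^sub>R a) + h x =
        t * t * ?Q (x + r' *\<^sub>R b + s' *\<^sub>R a)"
      by (rule second_difference_mean_value[OF t(1) inS' h]) (assumption | rule that)+
    have swap: "x + t *\<^sub>R b + t *\<^sub>R a = x + t *\<^sub>R a + t *\<^sub>R b"
      by (simp add: algebra_simps)
    have "t * t * ?P (x + r *\<^sub>R a + s *\<^sub>R b) = t * t * ?Q (x + r' *\<^sub>R b + s' *\<^sub>R a)"
      using 1(3) 2(3)[unfolded swap] by linarith
    then have "?P (x + r *\<^sub>R a + s *\<^sub>R b) = ?Q (x + r' *\<^sub>R b + s' *\<^sub>R a)"
      using t by simp
    moreover have "norm (x + r *\<^sub>R a + s *\<^sub>R b - x) \<le> t * (norm a + norm b + 1)"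
      using near[OF 1(1,2)] by (simp add: add.assoc)
    moreover have "norm (x + r' *\<^sub>R b + s' *\<^sub>R a - x) \<le> t * (norm a + norm b + 1)"
      using near[OF 2(2,1)] by (simp add: algebra_simps)
    ultimately show ?thesis by blast
  qed
  define t where "t = (\<lambda>n. c / (real n + 1))"
  have t: "0 < t n" "t n \<le> c" for n
    using c by (auto simp: t_def field_simps)
  have t0: "t \<longlonglongrightarrow> 0"
    unfolding t_def using LIMSEQ_Suc[OF lim_const_over_n[of c]] by (simp add: add.commute)
  from ex[OF t] obtain p q where pq: "\<And>n. ?P (p n) = ?Q (q n)"
    "\<And>n. norm (p n - x) \<le> t n * (norm a + norm b + 1)"
    "\<And>n. norm (q n - x) \<le> t n * (norm a + norm b + 1)"
    by metis
  have lim: "(\<lambda>n. t n * (norm a + norm b + 1)) \<longlonglongrightarrow> 0"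
    using tendsto_mult_left_zero[OF t0] by simp
  have "(\<lambda>n. p n - x) \<longlonglongrightarrow> 0" "(\<lambda>n. q n - x) \<longlonglongrightarrow> 0"
    by (rule Lim_null_comparison[OF _ lim], use pq in auto)+
  then have "p \<longlonglongrightarrow> x" "q \<longlonglongrightarrow> x"
    by (simp_all add: Lim_null[of _ x])
  then have "(\<lambda>n. ?P (p n)) \<longlonglongrightarrow> ?P x" "(\<lambda>n. ?Q (q n)) \<longlonglongrightarrow> ?Q x"
    using cont isCont_tendsto_compose by blast+
  then show ?thesis using pq(1) LIMSEQ_unique by auto
qed


section \<open>Divergence in coordinates\<close>

lemma D_axis:
  fixes h :: "real ^ 'n \<Rightarrow> real"
  assumes "h differentiable (at x)"
  shows "D h x v = (\<Sum>i\<in>UNIV. v $ i * D h x (axis i 1))"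
proof -
  have "D h x v = D h x (\<Sum>i\<in>UNIV. v $ i *\<^sub>R axis i 1)"
    using basis_expansion[of v] by (simp add: scalar_mult_eq_scaleR)
  also have "\<dots> = (\<Sum>i\<in>UNIV. v $ i * D h x (axis i 1))"
    using linear_D[OF assms] by (simp add: linear_sum linear_cmul)
  finally show ?thesis .
qed

text \<open>In the differentiated Leibniz formula only the identity permutation survives: at the
  unit matrix, a nonzero product over all \<open>j \<noteq> i\<close> forces \<open>p\<close> to fix
  every \<open>j \<noteq> i\<close>, and then by injectivity also \<open>i\<close>.\<close>

lemma D_det_at_mat1:
  fixes B :: "'a::euclidean_space \<Rightarrow> real ^ 'n ^ 'n"
  assumes diff: "\<And>i j. (\<lambda>x. B x $ i $ j) differentiable (at x)" and 1: "B x = mat 1"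
  shows "D (\<lambda>x. det (B x)) x v = (\<Sum>i\<in>UNIV. D (\<lambda>x. B x $ i $ i) x v)"
proof -
  let ?P = "{p. p permutes (UNIV :: 'n set)}"
  let ?t = "\<lambda>p. of_int (sign p) *
    (\<Sum>i\<in>UNIV. D (\<lambda>x. B x $ i $ p i) x v * (\<Prod>j\<in>UNIV - {i}. B x $ j $ p j))"
  have "D (\<lambda>x. det (B x)) x v = (\<Sum>p\<in>?P. ?t p)"
    unfolding det_def
    by (rule D_eqI) (intro derivative_intros has_derivative_prod has_derivative_D diff)
  also have "\<dots> = (\<Sum>p\<in>?P. if p = id then \<Sum>i\<in>UNIV. D (\<lambda>x. B x $ i $ i) x v else 0)"
  proof (rule sum.cong[OF refl])
    fix p assume p: "p \<in> ?P"
    show "?t p = (if p = id then \<Sum>i\<in>UNIV. D (\<lambda>x. B x $ i $ i) x v else 0)"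
    proof (cases "p = id")
      case True
      then show ?thesis by (simp add: 1 mat_def)
    next
      case False
      have zero: "(\<Prod>j\<in>UNIV - {i}. B x $ j $ p j) = 0" for i
      proof (rule ccontr)
        assume "(\<Prod>j\<in>UNIV - {i}. B x $ j $ p j) \<noteq> 0"
        then have fix_other: "p j = j" if "j \<noteq> i" for j
          using that by (auto simp: 1 mat_def split: if_splits)
        have "inj p" using p by (simp add: permutes_inj)
        then have "p i = i" using fix_other by (metis injD)
        then show False using fix_other False by (metis eq_id_iff)
      qed
      show ?thesis using False by (simp only: zero mult_zero_right sum.neutral_const if_False)
    qed
  qed
  also have "\<dots> = (\<Sum>i\<in>UNIV. D (\<lambda>x. B x $ i $ i) x v)"
    by (simp add: sum.delta' finite_permutations permutes_id)
  finally show ?thesis .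
qed

lemma differentiable_det:
  fixes B :: "'a::euclidean_space \<Rightarrow> real ^ 'n ^ 'n"
  assumes "\<And>i j. (\<lambda>x. B x $ i $ j) differentiable (at x)"
  shows "(\<lambda>x. det (B x)) differentiable (at x)"
proof -
  have "(\<lambda>x. \<Prod>i\<in>UNIV. B x $ i $ p i) differentiable (at x)" for p
    unfolding differentiable_def
    by (rule exI, rule has_derivative_prod[where f = "\<lambda>i x. B x $ i $ p i"])
      (rule has_derivative_D[OF assms])
  then show ?thesis unfolding det_def by (intro derivative_intros) auto
qed

text \<open>Multiplication by the constant matrix \<open>C\<close> moves the base value to the unit
  matrix, where the derivative of the determinant is a trace. Since \<open>det\<close> is
  multiplicative, this only introduces the factor \<open>det C\<close>, which is then removed by
  \<open>detC\<close>.\<close>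

lemma D_det:
  fixes B :: "'a::euclidean_space \<Rightarrow> real ^ 'n ^ 'n"
  assumes diff: "\<And>i j. (\<lambda>x. B x $ i $ j) differentiable (at x)" and C: "B x ** C = mat 1"
  shows "D (\<lambda>x. det (B x)) x v =
    det (B x) * (\<Sum>i\<in>UNIV. \<Sum>k\<in>UNIV. D (\<lambda>x. B x $ i $ k) x v * C $ k $ i)"
proof -
  have detC: "det (B x) * det C = 1" using C by (metis det_I det_mul)
  have ddet: "(\<lambda>x. det (B x)) differentiable (at x)"
    by (rule differentiable_det[OF diff])
  have "D (\<lambda>x. det (B x)) x v * det C = D (\<lambda>x. det (B x ** C)) x v"
    using D_mult[OF ddet, of "\<lambda>x. det C"] by (simp add: det_mul)
  also have "\<dots> = (\<Sum>i\<in>UNIV. D (\<lambda>x. (B x ** C) $ i $ i) x v)"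
    by (rule D_det_at_mat1[where B = "\<lambda>x. B x ** C", OF _ C]) (auto simp: matrix_matrix_mult_def intro!: derivative_intros diff)
  also have "\<dots> = (\<Sum>i\<in>UNIV. \<Sum>k\<in>UNIV. D (\<lambda>x. B x $ i $ k) x v * C $ k $ i)"
    by (simp add: matrix_matrix_mult_def D_sum D_mult diff)
  finally have *: "D (\<lambda>x. det (B x)) x v * det C =
    (\<Sum>i\<in>UNIV. \<Sum>k\<in>UNIV. D (\<lambda>x. B x $ i $ k) x v * C $ k $ i)" .
  have "r = b * (r * c)" if "b * c = 1" for r b c :: real
    using that by (simp add: mult.left_commute)
  from this[OF detC] show ?thesis unfolding *[symmetric] .
qed


section \<open>The coordinate expression of the divergence and its change of variables\<close>

definition coord_div :: "(real ^ 'n \<Rightarrow> real) \<Rightarrow> ('n \<Rightarrow> real ^ 'n \<Rightarrow> real) \<Rightarrow> real ^ 'n \<Rightarrow> real" where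
  "coord_div d a y = (\<Sum>i\<in>UNIV. D (\<lambda>z. sqrt (d z) * a i z) y (axis i 1)) / sqrt (d y)"

text \<open>The quotient \<open>D d / (2 d)\<close> is the logarithmic derivative of
  \<open>sqrt d\<close>, so the square roots drop out. In this form the expression is compared
  between charts and differentiated along the flow of the argument.\<close>

lemma coord_div_expand:
  assumes d: "d differentiable (at y)" "d y \<noteq> 0" and a: "\<And>i. a i differentiable (at y)"
  shows "coord_div d a y =
    (\<Sum>i\<in>UNIV. D (a i) y (axis i 1) + a i y * (D d y (axis i 1) / (2 * d y)))"
proof -
  have sq: "sqrt differentiable (at (d y))"
    using has_derivative_sqrt_nonzero[OF d(2)] differentiable_def by blast
  have dsq: "(\<lambda>z. sqrt (d z)) differentiable (at y)"
    using differentiable_chain_at[OF d(1) sq] by (simp add: o_def)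
  have "D (\<lambda>z. sqrt (d z)) y v = sqrt (d y) * (D d y v / (2 * d y))" for v
    using D_compose[OF sq d(1)] D_eqI[OF has_derivative_sqrt_nonzero[OF d(2)]]
    by (simp add: field_simps)
  then have "D (\<lambda>z. sqrt (d z) * a i z) y v =
      sqrt (d y) * (D (a i) y v + a i y * (D d y v / (2 * d y)))" for i v
    by (simp add: D_mult[OF dsq a] algebra_simps)
  then show ?thesis
    using d(2) by (simp add: coord_div_def flip: sum_distrib_left)
qed

text \<open>The second derivatives of the coordinate change that enter through the transformed vector
  field cancel those that enter, by Jacobi's formula, through the derivative of its determinant.\<close>

lemma coord_div_change:
  fixes \<phi> :: "real ^ 'n \<Rightarrow> real ^ 'n"
  defines "J \<equiv> \<lambda>z. (\<chi> k j. D (\<lambda>z. \<phi> z $ k) z (axis j 1)) :: real ^ 'n ^ 'n"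
  assumes N: "open N" "y \<in> N" and \<phi>: "Cinf N \<phi>"
    and C: "J y ** C = mat 1"
    and d: "d differentiable (at y)" "d y \<noteq> 0" and a: "\<And>i. a i differentiable (at y)"
    and d': "d' differentiable (at (\<phi> y))" "d' (\<phi> y) \<noteq> 0" and a': "\<And>k. a' k differentiable (at (\<phi> y))"
    and dd': "\<And>z. z \<in> N \<Longrightarrow> d z = d' (\<phi> z) * (det (J z))\<^sup>2"
    and aa': "\<And>z k. z \<in> N \<Longrightarrow> a' k (\<phi> z) = (\<Sum>j\<in>UNIV. J z $ k $ j * a j z)"
  shows "coord_div d a y = coord_div d' a' (\<phi> y)"
proof -
  define e :: "'n \<Rightarrow> real ^ 'n" where "e = (\<lambda>i. axis i 1)"
  have \<phi>k: "Cinf N (\<lambda>z. \<phi> z $ k)" for k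
    by (rule Cinf_bounded_linear[OF N(1) bounded_linear_vec_nth \<phi>])
  have \<phi>d: "\<phi> differentiable (at y)" using Cinf_differentiable[OF \<phi> N(2)] .
  have D\<phi>: "D \<phi> y v $ k = D (\<lambda>z. \<phi> z $ k) y v" for v k
    using D_bounded_linear[OF bounded_linear_vec_nth \<phi>d] by metis
  have Jd: "(\<lambda>z. J z $ k $ j) differentiable (at y)" for k j
    using Cinf_differentiable[OF Cinf_D[OF \<phi>k] N(2)] by (simp add: J_def)
  have C': "C ** J y = mat 1" using C matrix_left_right_inverse by blast
  have J_sym: "D (\<lambda>z. J z $ k $ j) y (e i) = D (\<lambda>z. J z $ k $ i) y (e j)" for k i j
    using symmetric_D[OF N \<phi>k] by (simp add: J_def e_def)
  have Jv: "D \<phi> y v = J y *v v" for v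
    by (subst vec_eq_iff, subst D\<phi>, subst D_axis[OF Cinf_differentiable[OF \<phi>k N(2)]])
      (simp add: J_def matrix_vector_mult_def mult.commute)
  have detJ: "det (J y) \<noteq> 0" using C by (metis det_I det_mul mult_zero_left zero_neq_one)
  have detJd: "(\<lambda>z. det (J z)) differentiable (at y)"
    by (rule differentiable_det[OF Jd])
  \<comment> \<open>\<open>C\<close> is the inverse of \<open>J y\<close>, so \<open>T v\<close> is
    the trace of the derivative of \<open>J\<close> along \<open>v\<close> times that inverse. By
    Jacobi's formula it is the logarithmic derivative of \<open>det J\<close>.\<close>
  define T where "T v = (\<Sum>i\<in>UNIV. \<Sum>k\<in>UNIV. D (\<lambda>z. J z $ i $ k) y v * C $ k $ i)" for v
  define av where "av = (\<chi> i. a i y)"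
  \<comment> \<open>Half the logarithmic derivative of
    \<open>d' (\<phi> z) * (det (J z))\<^sup>2\<close>; the square of the determinant accounts for
    the single summand \<open>T v\<close>.\<close>
  have Dd: "D d y v / (2 * d y) = D d' (\<phi> y) (D \<phi> y v) / (2 * d' (\<phi> y)) + T v" for v
  proof -
    have d'\<phi>: "(\<lambda>z. d' (\<phi> z)) differentiable (at y)"
      using differentiable_chain_at[OF \<phi>d d'(1)] by (simp add: o_def)
    have "D d y v = D (\<lambda>z. d' (\<phi> z) * (det (J z) * det (J z))) y v"
      using D_cong[OF N, of d] dd' by (simp add: power2_eq_square)
    also have "\<dots> = D d' (\<phi> y) (D \<phi> y v) * (det (J y) * det (J y))
        + d' (\<phi> y) * (2 * det (J y) * (det (J y) * T v))"
      using D_det[OF Jd C]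
      by (simp add: D_mult d'\<phi> detJd D_compose[OF d'(1) \<phi>d] T_def algebra_simps)
    finally show ?thesis
      using detJ d' N dd' by (simp add: field_simps power2_eq_square)
  qed
  have J_av: "(J y *v av) $ k = a' k (\<phi> y)" for k
    using aa'[OF N(2)] by (simp add: matrix_vector_mult_def av_def)
  have linT: "(\<Sum>i\<in>UNIV. a i y * T (e i)) = T av"
  proof -
    have "T av = (\<Sum>i\<in>UNIV. \<Sum>k\<in>UNIV. \<Sum>j\<in>UNIV. a j y * (D (\<lambda>z. J z $ i $ k) y (e j) * C $ k $ i))"
      unfolding T_def
      by (subst D_axis[OF Jd, of _ _ av]) (simp add: av_def e_def sum_distrib_right mult.assoc)
    also have "\<dots> = (\<Sum>i\<in>UNIV. \<Sum>j\<in>UNIV. \<Sum>k\<in>UNIV. a j y * (D (\<lambda>z. J z $ i $ k) y (e j) * C $ k $ i))"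
      by (rule sum.cong[OF refl sum.swap])
    also have "\<dots> = (\<Sum>j\<in>UNIV. \<Sum>i\<in>UNIV. \<Sum>k\<in>UNIV. a j y * (D (\<lambda>z. J z $ i $ k) y (e j) * C $ k $ i))"
      by (rule sum.swap)
    finally show ?thesis by (simp add: T_def sum_distrib_left)
  qed
  have "coord_div d a y = (\<Sum>i\<in>UNIV. D (a i) y (e i)) + (\<Sum>i\<in>UNIV. a i y * (D d y (e i) / (2 * d y)))"
    by (simp add: coord_div_expand[OF d a] sum.distrib e_def)
  also have "(\<Sum>i\<in>UNIV. a i y * (D d y (e i) / (2 * d y))) =
      (\<Sum>i\<in>UNIV. a i y * (D d' (\<phi> y) (D \<phi> y (e i)))) / (2 * d' (\<phi> y)) + T av"
    by (simp add: Dd distrib_left sum.distrib linT sum_divide_distrib)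
  also have "(\<Sum>i\<in>UNIV. a i y * (D d' (\<phi> y) (D \<phi> y (e i)))) = D d' (\<phi> y) (D \<phi> y av)"
    using D_axis[of "\<lambda>z. d' (\<phi> z)" y av] differentiable_chain_at[OF \<phi>d d'(1)]
    by (simp add: o_def D_compose[OF d'(1) \<phi>d] av_def e_def)
  also have "\<dots> = (\<Sum>k\<in>UNIV. a' k (\<phi> y) * D d' (\<phi> y) (e k))"
    by (subst D_axis[OF d'(1)]) (simp add: Jv J_av e_def)
  finally have lhs: "coord_div d a y = (\<Sum>i\<in>UNIV. D (a i) y (e i)) + T av
      + (\<Sum>k\<in>UNIV. a' k (\<phi> y) * D d' (\<phi> y) (e k)) / (2 * d' (\<phi> y))" by simp
  have Da': "D (a' k) (\<phi> y) (e k) =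
      (\<Sum>i\<in>UNIV. C $ i $ k * (\<Sum>j\<in>UNIV. D (\<lambda>z. J z $ k $ j) y (e i) * a j y + J y $ k $ j * D (a j) y (e i)))"
    for k
  proof -
    \<comment> \<open>A coordinate direction of the target is the image of \<open>C *v e k\<close>.
      The derivative of \<open>a' k\<close> can therefore be taken on the source side, where
      \<open>aa'\<close> expresses it by \<open>a\<close>.\<close>
    have "J y *v (C *v e k) = e k" using C by (simp add: matrix_vector_mul_assoc)
    then have "D (a' k) (\<phi> y) (e k) = D (a' k) (\<phi> y) (D \<phi> y (C *v e k))" by (simp add: Jv)
    also have "\<dots> = D (\<lambda>z. a' k (\<phi> z)) y (C *v e k)" by (simp add: D_compose[OF a' \<phi>d])
    also have "\<dots> = D (\<lambda>z. \<Sum>j\<in>UNIV. J z $ k $ j * a j z) y (C *v e k)"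
      by (rule fun_cong[OF D_cong[OF N aa']])
    also have "\<dots> = (\<Sum>i\<in>UNIV. (C *v e k) $ i * D (\<lambda>z. \<Sum>j\<in>UNIV. J z $ k $ j * a j z) y (e i))"
      unfolding e_def by (rule D_axis) (auto intro!: derivative_intros Jd a)
    also have "\<dots> = (\<Sum>i\<in>UNIV. C $ i $ k * D (\<lambda>z. \<Sum>j\<in>UNIV. J z $ k $ j * a j z) y (e i))"
      by (simp add: e_def matrix_vector_mul_component inner_axis)
    finally show ?thesis by (simp add: D_sum D_mult Jd a)
  qed
  have "(\<Sum>k\<in>UNIV. D (a' k) (\<phi> y) (e k)) =
      (\<Sum>k\<in>UNIV. \<Sum>i\<in>UNIV. C $ i $ k * (\<Sum>j\<in>UNIV. D (\<lambda>z. J z $ k $ j) y (e i) * a j y))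
      + (\<Sum>k\<in>UNIV. \<Sum>i\<in>UNIV. C $ i $ k * (\<Sum>j\<in>UNIV. J y $ k $ j * D (a j) y (e i)))"
    by (simp add: Da' sum.distrib distrib_left)
  \<comment> \<open>Exchanging the two directions in the second derivatives of \<open>\<phi>\<close>
    by \<open>J_sym\<close> turns this trace into the same \<open>T av\<close> that came from the
    determinant.\<close>
  also have "(\<Sum>k\<in>UNIV. \<Sum>i\<in>UNIV. C $ i $ k * (\<Sum>j\<in>UNIV. D (\<lambda>z. J z $ k $ j) y (e i) * a j y)) = T av"
    unfolding T_def
    by (subst D_axis[OF Jd, of _ _ av], subst J_sym) (simp add: av_def e_def mult.commute)
  also have "(\<Sum>k\<in>UNIV. \<Sum>i\<in>UNIV. C $ i $ k * (\<Sum>j\<in>UNIV. J y $ k $ j * D (a j) y (e i))) =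
      (\<Sum>i\<in>UNIV. \<Sum>j\<in>UNIV. (C ** J y) $ i $ j * D (a j) y (e i))"
  proof -
    have "(\<Sum>k\<in>UNIV. \<Sum>i\<in>UNIV. C $ i $ k * (\<Sum>j\<in>UNIV. J y $ k $ j * D (a j) y (e i))) =
        (\<Sum>k\<in>UNIV. \<Sum>i\<in>UNIV. \<Sum>j\<in>UNIV. C $ i $ k * J y $ k $ j * D (a j) y (e i))"
      by (simp only: sum_distrib_left mult.assoc)
    also have "\<dots> = (\<Sum>i\<in>UNIV. \<Sum>k\<in>UNIV. \<Sum>j\<in>UNIV. C $ i $ k * J y $ k $ j * D (a j) y (e i))"
      by (rule sum.swap)
    also have "\<dots> = (\<Sum>i\<in>UNIV. \<Sum>j\<in>UNIV. \<Sum>k\<in>UNIV. C $ i $ k * J y $ k $ j * D (a j) y (e i))"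
      by (rule sum.cong[OF refl sum.swap])
    also have "\<dots> = (\<Sum>i\<in>UNIV. \<Sum>j\<in>UNIV. (C ** J y) $ i $ j * D (a j) y (e i))"
      by (simp only: matrix_matrix_mult_def vec_lambda_beta sum_distrib_right)
    finally show ?thesis .
  qed
  also have "\<dots> = (\<Sum>i\<in>UNIV. D (a i) y (e i))"
    by (simp add: C' mat_def if_distrib[of "\<lambda>x. x * _"] cong: if_cong)
  finally show ?thesis
    by (simp add: lhs coord_div_expand[OF d' a'] sum.distrib e_def sum_divide_distrib)
qed

lemma coord_div_cong:
  assumes "open B" "y \<in> B" "\<And>i z. z \<in> B \<Longrightarrow> a i z = b i z"
  shows "coord_div d a y = coord_div d b y"
proof -
  have "D (\<lambda>z. sqrt (d z) * a i z) y = D (\<lambda>z. sqrt (d z) * b i z) y" for i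
    by (rule D_cong[OF assms(1,2)]) (simp add: assms(3))
  then show ?thesis by (simp add: coord_div_def)
qed

lemma Cinf_coord_div:
  assumes "open B" "Cinf B d" "\<And>y. y \<in> B \<Longrightarrow> d y \<noteq> 0" "\<And>i. Cinf B (a i)"
  shows "Cinf B (coord_div d a)"
  unfolding coord_div_def[abs_def]
  by (intro Cinf_divide Cinf_sum Cinf_D Cinf_mult Cinf_sqrt assms) (use assms in auto)

section \<open>Functions of parameter and point along graphs and slices\<close>

lemma D_graph:
  fixes G :: "real \<times> 'a::euclidean_space \<Rightarrow> real"
  assumes G: "G differentiable (at (v y, y))" and v: "v differentiable (at y)"
  shows "D (\<lambda>y. G (v y, y)) y a = D v y a * D G (v y, y) (1, 0) + D G (v y, y) (0, a)"
proof -
  have "D (\<lambda>y. G (v y, y)) y a = D G (v y, y) (D v y a, a)"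
    using D_compose[of G "\<lambda>y. (v y, y)" y a] G v by (simp add: differentiable_Pair D_Pair)
  \<comment> \<open>The splitting separates differentiation through the parameter from
    differentiation at a fixed parameter. This is the origin of the difference between the
    divergence of the composite field and that of the field with frozen parameter.\<close>
  also have "(D v y a, a) = D v y a *\<^sub>R (1, 0) + (0, a)" by simp
  finally show ?thesis
    using linear_D[OF G] by (simp only: linear_add linear_cmul) simp
qed

lemma differentiable_graph:
  assumes "G differentiable (at (v y, y))" "v differentiable (at y)"
  shows "(\<lambda>y. G (v y, y)) differentiable (at y)"
  using differentiable_chain_at[of "\<lambda>y. (v y, y)" y G] assms by (simp add: differentiable_Pair o_def)

lemma D_slice:
  fixes G :: "real \<times> 'a::euclidean_space \<Rightarrow> real"
  shows "G differentiable (at (s, y)) \<Longrightarrow> D (\<lambda>y. G (s, y)) y a = D G (s, y) (0, a)"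
  using D_graph[of G "\<lambda>_. s" y a] by simp

lemma differentiable_slice:
  "G differentiable (at (s, y)) \<Longrightarrow> (\<lambda>y. G (s, y)) differentiable (at y)"
  using differentiable_graph[of G "\<lambda>_. s"] by simp

lemma D_param:
  assumes "G differentiable (at (s, y))"
  shows "D (\<lambda>r. G (r, y)) s k = D G (s, y) (k, 0)"
  using D_compose[of G "\<lambda>r. (r, y)" s k] assms by (simp add: differentiable_Pair D_Pair)

lemma has_real_derivative_D:
  fixes G :: "real \<Rightarrow> real"
  assumes "G differentiable (at t)"
  shows "(G has_real_derivative D G t 1) (at t)"
proof -
  have "D G t k = D G t 1 * k" for k
    using linear_cmul[OF linear_D[OF assms], of k 1] by simp
  then have "D G t = (*) (D G t 1)" by blast
  then show ?thesis
    using has_derivative_D[OF assms] by (simp add: has_field_derivative_def)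
qed

lemma has_real_derivative_param:
  fixes G :: "real \<times> 'a::euclidean_space \<Rightarrow> real"
  assumes "G differentiable (at (s, y))"
  shows "((\<lambda>r. G (r, y)) has_real_derivative D G (s, y) (1, 0)) (at s)"
proof -
  have "(\<lambda>r. G (r, y)) differentiable (at s)"
    using differentiable_chain_at[of "\<lambda>r. (r, y)" s G] assms by (simp add: differentiable_Pair o_def)
  from has_real_derivative_D[OF this] show ?thesis by (simp add: D_param[OF assms])
qed

text \<open>\<open>T\<close> may have boundary points, such as \<open>0\<close> in
  \<open>{0..}\<close>, but the slice at a time in \<open>T\<close> meets only points of
  \<open>T \<times> S\<close>, where each local extension agrees with \<open>F\<close>.\<close>

lemma Cinf_slice:
  fixes F :: "real \<times> 'a::euclidean_space \<Rightarrow> real"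
  assumes S: "open S" and F: "smooth_on (T \<times> S) F" and t: "t \<in> T"
  shows "Cinf S (\<lambda>y. F (t, y))"
  unfolding Cinf_def
proof (intro allI Ck_on_local)
  fix k y assume y: "y \<in> S"
  then obtain N G where N: "open N" "(t, y) \<in> N" "\<And>k. Ck_on k G N"
    "\<And>z. z \<in> N \<inter> (T \<times> S) \<Longrightarrow> G z = F z"
    using F t unfolding smooth_on_def by (metis SigmaI)
  obtain I B where IB: "open I" "t \<in> I" "open B" "y \<in> B" "I \<times> B \<subseteq> N"
    using open_prod_elim[OF N(1,2)] by (metis mem_Sigma_iff)
  have "Cinf (B \<inter> S) (\<lambda>y. G (t, y))"
    by (rule Cinf_compose[of _ N]) (use N IB S in \<open>auto simp: Cinf_def intro!: Ck_on_Pair Ck_on_const Ck_on_id\<close>)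
  then have "Ck_on k (\<lambda>y. G (t, y)) (B \<inter> S)" by (simp add: Cinf_def)
  then have "Ck_on k (\<lambda>y. F (t, y)) (B \<inter> S)"
    by (rule Ck_on_cong[rotated 2]) (use N(4) IB S t in auto)
  then show "\<exists>N. open N \<and> y \<in> N \<and> Ck_on k (\<lambda>y. F (t, y)) N"
    using IB S y by (intro exI[of _ "B \<inter> S"]) auto
qed

text \<open>\<open>G\<close> is a two-sided continuation of \<open>h\<close> at \<open>p\<close>.
  Its ordinary derivative is also the derivative within \<open>{0..}\<close>, and the latter is
  unique because \<open>t\<close> is a limit point of \<open>{0..}\<close> from the right, even for
  \<open>t = 0\<close>.\<close>

lemma time_deriv_eq:
  assumes "open I" "t \<in> I" "0 \<le> t" and eq: "\<And>r. r \<in> I \<Longrightarrow> 0 \<le> r \<Longrightarrow> h r p = G r"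
    and G: "(G has_real_derivative G') (at t)"
  shows "time_deriv h t p = G'"
proof -
  obtain e where e: "e > 0" "ball t e \<subseteq> I" using assms(1,2) open_contains_ball by blast
  have "(G has_vector_derivative G') (at t within {0..})"
    using G has_vector_derivative_at_within
    by (auto simp: has_real_derivative_iff_has_vector_derivative)
  then have "((\<lambda>r. h r p) has_vector_derivative G') (at t within {0..})"
    by (rule has_vector_derivative_transform_within[OF _ e(1)])
      (use e assms(3) eq in \<open>auto simp: subset_iff dist_commute\<close>)
  moreover have "t islimpt {0..}"
    by (rule islimpt_subset[OF islimpt_greaterThanLessThan1[of t "t + 1"]]) (use assms(3) in auto)
  ultimately show ?thesis
    unfolding time_deriv_def by (intro vector_derivative_within) (simp_all add: trivial_limit_within)
qed

text \<open>Local form of the theorem: \<open>F\<close> is the extended solution, \<open>v\<close>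
  its profile at time \<open>t\<close>, and \<open>x\<close> holds the components of
  \<open>X\<close> at the base point. The first bracket on the right is
  \<open>X(Y(u)) - Y(X(u))\<close>, where \<open>Y\<close> has the components \<open>fs\<close> with
  parameter frozen at \<open>v y\<close>. Since \<open>x\<close> is constant, \<open>W\<close> is a
  separate function tied to \<open>D v y x\<close> only at \<open>y\<close>; away from
  \<open>y\<close> it may reflect how \<open>X\<close> varies.\<close>

lemma conservation_law_coords:
  fixes F :: "real \<times> (real ^ 'n) \<Rightarrow> real" and f :: "'n \<Rightarrow> real \<times> (real ^ 'n) \<Rightarrow> real"
    and x :: "real ^ 'n"
  defines "fs \<equiv> \<lambda>i z. D (f i) z (1, 0)"
  assumes I: "open I" "t \<in> I" and B: "open B" "y \<in> B"
    and F: "Cinf (I \<times> B) F" and f: "\<And>i. Cinf (UNIV \<times> B) (f i)"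
    and d: "Cinf B d" "\<And>y. y \<in> B \<Longrightarrow> d y \<noteq> 0"
    and v: "v = (\<lambda>y. F (t, y))"
    and eq: "\<And>y. y \<in> B \<Longrightarrow> D F (t, y) (1, 0) + coord_div d (\<lambda>i y. f i (v y, y)) y = 0"
    and W: "W differentiable (at y)" "W y = D v y x"
    and F': "F' = (\<lambda>r. D (\<lambda>y. F (r, y)) y x)"
  shows "D F' t 1 + coord_div d (\<lambda>i y. W y * fs i (v y, y)) y =
    - (D (\<lambda>z. \<Sum>i\<in>UNIV. fs i (v y, z) * D v z (axis i 1)) y x
       - (\<Sum>i\<in>UNIV. fs i (v y, y) * D W y (axis i 1)))
    - D (coord_div d (\<lambda>i z. f i (v y, z))) y x"
proof -
  define e :: "'n \<Rightarrow> real ^ 'n" where "e = (\<lambda>i. axis i 1)"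
  define fy where "fy = (\<lambda>i z. D (f i) z (0, e i))"
  define L where "L = (\<lambda>i y. D d y (e i) / (2 * d y))"
  \<comment> \<open>\<open>Q (s, z)\<close> is the divergence of the field with parameter
    \<open>s\<close> at the point \<open>z\<close>. As one function of both variables it has a
    derivative in the parameter as well as one along \<open>x\<close> at fixed parameter.\<close>
  define Q where "Q = (\<lambda>z. \<Sum>i\<in>UNIV. fy i z + f i z * L i (snd z))"
  let ?z = "(v y, y)"
  have oI: "open (I \<times> B)" and oU: "open (UNIV \<times> B :: (real \<times> (real ^ 'n)) set)"
    using I B by (auto intro: open_Times)
  have L: "Cinf B (L i)" for i
    unfolding L_def using d by (intro Cinf_divide B Cinf_D Cinf_mult Cinf_const) auto
  have fs: "Cinf (UNIV \<times> B) (fs i)" and fy: "Cinf (UNIV \<times> B) (fy i)" for i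
    unfolding fs_def fy_def by (intro Cinf_D f)+
  have snd: "Cinf (UNIV \<times> B) (\<lambda>z :: real \<times> (real ^ 'n). snd z)"
    by (rule Cinf_bounded_linear[OF oU bounded_linear_snd Cinf_id[OF oU]])
  have Ls: "Cinf (UNIV \<times> B) (\<lambda>z :: real \<times> (real ^ 'n). L i (snd z))" for i
    by (rule Cinf_compose[OF oU L snd]) auto
  have Q: "Cinf (UNIV \<times> B) Q"
    unfolding Q_def by (intro Cinf_sum Cinf_add Cinf_mult oU fy f Ls)
  have diff: "g differentiable (at (s, z))" if "Cinf (UNIV \<times> B) g" "z \<in> B"
    for g :: "real \<times> (real ^ 'n) \<Rightarrow> real" and s z
    using Cinf_differentiable that by blast
  have Fd: "F differentiable (at (t, z))" if "z \<in> B" for z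
    using Cinf_differentiable[OF F] I that by blast
  have vC: "Cinf B v"
    unfolding v by (rule Cinf_compose[OF B(1) F]) (use I in \<open>auto intro!: Cinf_Pair B Cinf_const Cinf_id\<close>)
  have vd: "v differentiable (at z)" and vdd: "(\<lambda>z. D v z a) differentiable (at z)" if "z \<in> B" for z a
    using Cinf_differentiable[OF vC] Cinf_differentiable[OF Cinf_D[OF vC]] that by blast+
  have dd: "d differentiable (at z)" "d z \<noteq> 0" if "z \<in> B" for z
    using Cinf_differentiable[OF d(1)] d(2) that by blast+

  have div_fixed: "coord_div d (\<lambda>i z. f i (s, z)) z = Q (s, z)" if "z \<in> B" for s z
    by (simp add: coord_div_expand[OF dd[OF that] differentiable_slice[OF diff[OF f that]]]
        D_slice[OF diff[OF f that]] Q_def fy_def L_def e_def)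
  have div_graph: "coord_div d (\<lambda>i z. f i (v z, z)) z =
      Q (v z, z) + (\<Sum>i\<in>UNIV. fs i (v z, z) * D v z (e i))" if "z \<in> B" for z
    by (simp add: coord_div_expand[OF dd[OF that] differentiable_graph[where v=v, OF diff[OF f that] vd[OF that]]]
        D_graph[where v=v, OF diff[OF f that] vd[OF that]] Q_def fy_def fs_def L_def e_def
        sum.distrib algebra_simps)

  have "D F' t 1 = D (\<lambda>z. D F z (0, x)) (t, y) (1, 0)"
  proof -
    have "D F' t 1 = D (\<lambda>r. D F (r, y) (0, x)) t 1"
      by (rule fun_cong[OF D_cong[OF I]])
        (use Cinf_differentiable[OF F] B in \<open>auto simp: F' D_slice\<close>)
    also have "\<dots> = D (\<lambda>z. D F z (0, x)) (t, y) (1, 0)"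
      by (rule D_param[OF Cinf_differentiable[OF Cinf_D[OF F]]]) (use I B in auto)
    finally show ?thesis .
  qed
  \<comment> \<open>Time and space derivatives are exchanged for the extension on the open set
    \<open>I \<times> B\<close>, which includes the case \<open>t = 0\<close>.\<close>
  also have "\<dots> = D (\<lambda>z. D F z (1, 0)) (t, y) (0, x)"
    by (rule symmetric_D[OF oI _ F]) (use I B in auto)
  also have "\<dots> = D (\<lambda>z. D F (t, z) (1, 0)) y x"
    by (rule D_slice[OF Cinf_differentiable[OF Cinf_D[OF F]], symmetric]) (use I B in auto)
  \<comment> \<open>The law enters here, at the fixed time \<open>t\<close> and at all points of
    \<open>B\<close>, which is what a derivative in space requires.\<close>
  also have "\<dots> = D (\<lambda>z. - 1 * (Q (v z, z) + (\<Sum>i\<in>UNIV. fs i (v z, z) * D v z (e i)))) y x"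
    by (rule fun_cong[OF D_cong[OF B]]) (use eq div_graph in fastforce)
  also have "\<dots> = - (D v y x * D Q ?z (1, 0) + D Q ?z (0, x) +
      (\<Sum>i\<in>UNIV. (D v y x * D (fs i) ?z (1, 0) + D (fs i) ?z (0, x)) * D v y (e i)
        + fs i ?z * D (\<lambda>z. D v z (e i)) y x))"
  proof -
    have Qd: "(\<lambda>z. Q (v z, z)) differentiable (at y)"
      by (rule differentiable_graph[where v=v, OF diff[OF Q B(2)] vd[OF B(2)]])
    have fsd: "(\<lambda>z. fs i (v z, z)) differentiable (at y)" for i
      by (rule differentiable_graph[where v=v, OF diff[OF fs B(2)] vd[OF B(2)]])
    have sd: "(\<lambda>z. fs i (v z, z) * D v z (e i)) differentiable (at y)" for i
      by (intro derivative_intros fsd vdd B)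
    have Sd: "(\<lambda>z. \<Sum>i\<in>UNIV. fs i (v z, z) * D v z (e i)) differentiable (at y)"
      by (rule differentiable_sum) (simp_all add: sd)
    show ?thesis
      by (subst D_mult[OF differentiable_const differentiable_add[OF Qd Sd]])
        (simp add: D_add[OF Qd Sd] D_sum[OF sd] D_mult[OF fsd vdd[OF B(2)]]
          D_graph[where v=v, OF diff[OF Q B(2)] vd[OF B(2)]]
          D_graph[where v=v, OF diff[OF fs B(2)] vd[OF B(2)]])
  qed
  finally have time: "D F' t 1 = \<dots>" .

  have wdiv: "coord_div d (\<lambda>i z. W z * fs i (v z, z)) y =
      (\<Sum>i\<in>UNIV. D W y (e i) * fs i ?z
        + W y * (D v y (e i) * D (fs i) ?z (1, 0) + D (fs i) ?z (0, e i) + fs i ?z * L i y))"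
  proof -
    have g: "(\<lambda>z. fs i (v z, z)) differentiable (at y)" for i
      by (rule differentiable_graph[where v=v, OF diff[OF fs B(2)] vd[OF B(2)]])
    have "(\<lambda>z. W z * fs i (v z, z)) differentiable (at y)" for i
      by (intro derivative_intros W g)
    then show ?thesis
      by (simp add: coord_div_expand[OF dd[OF B(2)]] D_mult W g
          D_graph[where v=v, OF diff[OF fs B(2)] vd[OF B(2)]] L_def e_def algebra_simps)
  qed
  have Qs: "D Q ?z (1, 0) = (\<Sum>i\<in>UNIV. D (fs i) ?z (0, e i) + fs i ?z * L i y)"
  proof -
    have "D (fy i) ?z (1, 0) = D (fs i) ?z (0, e i)" for i
      unfolding fy_def fs_def by (rule symmetric_D[OF oU _ f]) (use B in auto)
    moreover have "D (\<lambda>z :: real \<times> (real ^ 'n). L i (snd z)) ?z (1, 0) = 0" for i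
      using D_param[where s = "v y" and k = 1, OF diff[OF Ls[of i] B(2)]] by simp
    ultimately show ?thesis
      unfolding Q_def
      by (simp add: D_sum D_add D_mult diff[OF fy B(2)] diff[OF f B(2)] diff[OF Ls B(2)] fs_def)
  qed
  have lie: "D (\<lambda>z. \<Sum>i\<in>UNIV. fs i (v y, z) * D v z (e i)) y x =
      (\<Sum>i\<in>UNIV. D (fs i) ?z (0, x) * D v y (e i) + fs i ?z * D (\<lambda>z. D v z (e i)) y x)"
    using B by (simp add: D_sum D_mult D_slice diff fs vdd differentiable_slice)
  have Xdiv: "D (coord_div d (\<lambda>i z. f i (v y, z))) y x = D Q ?z (0, x)"
    using D_cong[OF B div_fixed[where s = "v y"]] D_slice[OF diff[OF Q B(2)]] by simp
  show ?thesis
    unfolding e_def[symmetric, THEN fun_cong] time wdiv lie Xdiv Qs W(2)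
    by (simp add: sum.distrib sum_distrib_left algebra_simps)
qed


section \<open>Calculus on manifolds\<close>

locale smooth_mfd =
  fixes M :: "'a topology" and A :: "('a, 'n::finite) chart set"
  assumes mfd: "smooth_manifold M A"
begin

section \<open>Charts and smooth functions on the manifold\<close>

lemma is_chart: "c \<in> A \<Longrightarrow> is_chart M c"
  using mfd by (simp add: smooth_manifold_def)

lemma openin_cdom: "c \<in> A \<Longrightarrow> openin M (cdom c)"
  using is_chart by (simp add: is_chart_def)

lemma open_cmap_cdom: "c \<in> A \<Longrightarrow> open (cmap c ` cdom c)"
  using is_chart by (simp add: is_chart_def)

lemma cdom_subset: "c \<in> A \<Longrightarrow> cdom c \<subseteq> topspace M"
  using openin_cdom openin_subset by blast

lemma chart_around:
  assumes "p \<in> topspace M"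
  obtains c where "c \<in> A" "p \<in> cdom c"
  using mfd assms unfolding smooth_manifold_def by blast

lemma inj_on_cmap:
  assumes "c \<in> A"
  shows "inj_on (cmap c) (cdom c)"
proof -
  have "homeomorphic_map (subtopology M (cdom c)) (top_of_set (cmap c ` cdom c)) (cmap c)"
    using is_chart[OF assms] by (simp add: is_chart_def)
  from homeomorphic_imp_injective_map[OF this] show ?thesis
    using cdom_subset[OF assms] by (simp add: Int_absorb1)
qed

lemma cinv_cmap [simp]: "c \<in> A \<Longrightarrow> p \<in> cdom c \<Longrightarrow> cinv c (cmap c p) = p"
  unfolding cinv_def by (rule inv_into_f_f[OF inj_on_cmap])

lemma cmap_cinv [simp]: "y \<in> cmap c ` cdom c \<Longrightarrow> cmap c (cinv c y) = y"
  unfolding cinv_def by (rule f_inv_into_f)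

lemma cinv_in: "y \<in> cmap c ` cdom c \<Longrightarrow> cinv c y \<in> cdom c"
  unfolding cinv_def by (rule inv_into_into)

lemma open_cmap_image:
  assumes c: "c \<in> A" and W: "openin M W"
  shows "open (cmap c ` (cdom c \<inter> W))"
proof -
  have "open_map (subtopology M (cdom c)) (top_of_set (cmap c ` cdom c)) (cmap c)"
    using is_chart[OF c] homeomorphic_imp_open_map by (auto simp: is_chart_def)
  moreover have "openin (subtopology M (cdom c)) (cdom c \<inter> W)"
    using W by (rule openin_subtopology_Int2)
  ultimately have "openin (top_of_set (cmap c ` cdom c)) (cmap c ` (cdom c \<inter> W))"
    by (simp add: open_map_def)
  then show ?thesis
    using open_cmap_cdom[OF c] openin_open_eq by blast
qed

lemma open_cmap_image': "c \<in> A \<Longrightarrow> openin M W \<Longrightarrow> W \<subseteq> cdom c \<Longrightarrow> open (cmap c ` W)"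
  using open_cmap_image[of c W] by (simp add: Int_absorb1)

lemma Cinf_transition:
  assumes "c \<in> A" "c' \<in> A"
  shows "Cinf (cmap c ` (cdom c \<inter> cdom c')) (\<lambda>y. cmap c' (cinv c y))"
proof -
  have "smooth_on (cmap c ` (cdom c \<inter> cdom c')) (cmap c' \<circ> cinv c)"
    using mfd assms by (simp add: smooth_manifold_def)
  from smooth_on_imp_Cinf[OF open_cmap_image[OF assms(1) openin_cdom[OF assms(2)]] this]
  show ?thesis by (simp add: o_def)
qed

lemma smooth_fun_Cinf:
  assumes "c \<in> A" "openin M W" "smooth_fun A W h"
  shows "Cinf (cmap c ` (cdom c \<inter> W)) (\<lambda>y. h (cinv c y))"
proof -
  have "smooth_on (cmap c ` (cdom c \<inter> W)) (h \<circ> cinv c)"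
    using assms by (simp add: smooth_fun_def)
  from smooth_on_imp_Cinf[OF open_cmap_image[OF assms(1,2)] this]
  show ?thesis by (simp add: o_def)
qed

text \<open>\<open>smooth_fun\<close> tests every chart of the atlas. From one chart the others are
  reached by composition with the smooth transition maps.\<close>

lemma Cinf_smooth_fun:
  assumes c: "c \<in> A" and W: "openin M W" "W \<subseteq> cdom c" and h: "Cinf (cmap c ` W) (\<lambda>y. h (cinv c y))"
  shows "smooth_fun A W h"
  unfolding smooth_fun_def
proof
  fix c' assume c': "c' \<in> A"
  let ?S = "cmap c' ` (cdom c' \<inter> W)"
  have S: "open ?S" by (rule open_cmap_image[OF c' W(1)])
  have "Cinf ?S (\<lambda>y. h (cinv c (cmap c (cinv c' y))))"
  proof (rule Cinf_compose[OF S h])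
    show "Cinf ?S (\<lambda>y. cmap c (cinv c' y))"
      by (rule Cinf_subset[OF Cinf_transition[OF c' c]]) (use W in auto)
    show "(\<lambda>y. cmap c (cinv c' y)) ` ?S \<subseteq> cmap c ` W"
      using c' by auto
  qed
  then have "Cinf ?S (h \<circ> cinv c')"
    by (rule Cinf_cong[OF S, rotated]) (use c c' W in auto)
  then show "smooth_on ?S (h \<circ> cinv c')"
    by (rule Cinf_imp_smooth_on[OF S])
qed

lemma smooth_near_iff:
  assumes "c \<in> A" "p \<in> cdom c"
  shows "smooth_near M A p h \<longleftrightarrow>
    (\<exists>W. openin M W \<and> p \<in> W \<and> W \<subseteq> cdom c \<and> Cinf (cmap c ` W) (\<lambda>y. h (cinv c y)))"
proof
  assume "smooth_near M A p h"
  then obtain W where W: "openin M W" "p \<in> W" "smooth_fun A W h"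
    unfolding smooth_near_def by blast
  show "\<exists>W. openin M W \<and> p \<in> W \<and> W \<subseteq> cdom c \<and> Cinf (cmap c ` W) (\<lambda>y. h (cinv c y))"
    by (rule exI[of _ "cdom c \<inter> W"])
      (use smooth_fun_Cinf[OF assms(1) W(1,3)] openin_Int[OF openin_cdom[OF assms(1)] W(1)] W assms in auto)
qed (use Cinf_smooth_fun[OF assms(1)] in \<open>auto simp: smooth_near_def\<close>)

lemma smooth_near_cdomI:
  assumes "c \<in> A" "p \<in> cdom c" "Cinf (cmap c ` cdom c) (\<lambda>y. h (cinv c y))"
  shows "smooth_near M A p h"
  using smooth_near_iff[OF assms(1,2)] assms openin_cdom by blast

lemma smooth_near_differentiable:
  assumes "c \<in> A" "p \<in> cdom c" "smooth_near M A p h"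
  shows "(\<lambda>y. h (cinv c y)) differentiable (at (cmap c p))"
  using assms smooth_near_iff[OF assms(1,2)] Cinf_differentiable by blast

section \<open>Tangent vectors in coordinates\<close>

lemma chart_tvec_apply:
  "smooth_near M A p h \<Longrightarrow> chart_tvec M A c p a h = D (\<lambda>y. h (cinv c y)) (cmap c p) a"
  by (simp add: chart_tvec_def o_def)

lemma chart_tvec_not_smooth: "\<not> smooth_near M A p h \<Longrightarrow> chart_tvec M A c p a h = 0"
  by (simp add: chart_tvec_def)

lemma smooth_near_coordinate:
  assumes "c \<in> A" "p \<in> cdom c"
  shows "smooth_near M A p (\<lambda>q. cmap c q $ i)"
proof (rule smooth_near_cdomI[OF assms])
  have o: "open (cmap c ` cdom c)" by (rule open_cmap_cdom[OF assms(1)])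
  show "Cinf (cmap c ` cdom c) (\<lambda>y. cmap c (cinv c y) $ i)"
    by (rule Cinf_cong[OF o _ Cinf_bounded_linear[OF o bounded_linear_vec_nth Cinf_id[OF o]]]) auto
qed

lemma component_chart_tvec [simp]:
  assumes "c \<in> A" "p \<in> cdom c"
  shows "component c i (chart_tvec M A c p a) = a $ i"
proof -
  have "component c i (chart_tvec M A c p a) = D (\<lambda>y. cmap c (cinv c y) $ i) (cmap c p) a"
    unfolding component_def by (rule chart_tvec_apply[OF smooth_near_coordinate[OF assms]])
  also have "\<dots> = D (\<lambda>y. y $ i) (cmap c p) a"
    by (rule fun_cong[OF D_cong[OF open_cmap_cdom[OF assms(1)]]]) (use assms in auto)
  also have "\<dots> = a $ i"
    by (rule D_eqI) (rule bounded_linear_imp_has_derivative[OF bounded_linear_vec_nth])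
  finally show ?thesis .
qed

text \<open>The chain rule through the transition map. On functions not smooth near \<open>p\<close>
  both sides take the default value \<open>0\<close>, so they are equal as operators.\<close>

lemma chart_tvec_change:
  assumes c: "c \<in> A" "p \<in> cdom c" and c': "c' \<in> A" "p \<in> cdom c'"
  shows "chart_tvec M A c p a = chart_tvec M A c' p (D (\<lambda>y. cmap c' (cinv c y)) (cmap c p) a)"
proof
  fix h
  show "chart_tvec M A c p a h = chart_tvec M A c' p (D (\<lambda>y. cmap c' (cinv c y)) (cmap c p) a) h"
  proof (cases "smooth_near M A p h")
    case True
    let ?S = "cmap c ` (cdom c \<inter> cdom c')"
    have S: "open ?S" "cmap c p \<in> ?S"
      using open_cmap_image[OF c(1) openin_cdom[OF c'(1)]] c c' by auto
    have "D (\<lambda>y. h (cinv c y)) (cmap c p) a = D (\<lambda>y. h (cinv c' (cmap c' (cinv c y)))) (cmap c p) a"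
      by (rule fun_cong[OF D_cong[OF S]]) (use c c' in auto)
    also have "\<dots> = D (\<lambda>y. h (cinv c' y)) (cmap c' p) (D (\<lambda>y. cmap c' (cinv c y)) (cmap c p) a)"
      using D_compose[of "\<lambda>y. h (cinv c' y)" "\<lambda>y. cmap c' (cinv c y)" "cmap c p" a] c
        smooth_near_differentiable[OF c' True] Cinf_differentiable[OF Cinf_transition[OF c(1) c'(1)] S(2)]
      by simp
    finally show ?thesis by (simp add: chart_tvec_apply[OF True])
  qed (simp add: chart_tvec_not_smooth)
qed

lemma chart_tvec_in_tangent_space [simp]:
  "c \<in> A \<Longrightarrow> p \<in> cdom c \<Longrightarrow> chart_tvec M A c p a \<in> tangent_space M A p"
  unfolding tangent_space_def by blast

text \<open>Membership in \<open>tangent_space\<close> provides some chart representing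
  \<open>v\<close>. After a change of chart the given one does, and the coefficients are recovered
  as the values of \<open>v\<close> on the coordinate functions.\<close>

lemma tangent_space_chart:
  assumes "c \<in> A" "p \<in> cdom c" "v \<in> tangent_space M A p"
  shows "v = chart_tvec M A c p (\<chi> i. component c i v)"
proof -
  obtain a where a: "v = chart_tvec M A c p a"
    using assms chart_tvec_change unfolding tangent_space_def by blast
  have "(\<chi> i. component c i v) = a"
    unfolding a by (simp add: assms vec_eq_iff)
  then show ?thesis using a by simp
qed

lemma tangent_space_apply:
  assumes "c \<in> A" "p \<in> cdom c" "v \<in> tangent_space M A p" "smooth_near M A p h"
  shows "v h = D (\<lambda>y. h (cinv c y)) (cmap c p) (\<chi> i. component c i v)"
  using tangent_space_chart[OF assms(1-3)] chart_tvec_apply[OF assms(4)] by metis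

lemma tangent_space_apply_sum:
  assumes "c \<in> A" "p \<in> cdom c" "v \<in> tangent_space M A p" "smooth_near M A p h"
  shows "v h = (\<Sum>i\<in>UNIV. component c i v * D (\<lambda>y. h (cinv c y)) (cmap c p) (axis i 1))"
  unfolding tangent_space_apply[OF assms]
  by (subst D_axis[OF smooth_near_differentiable[OF assms(1,2,4)]]) simp

lemma tangent_space_not_smooth:
  assumes "v \<in> tangent_space M A p" "\<not> smooth_near M A p h"
  shows "v h = 0"
  using assms by (auto simp: tangent_space_def chart_tvec_not_smooth)

lemma chart_tvec_add:
  assumes "c \<in> A" "p \<in> cdom c"
  shows "chart_tvec M A c p (a + b) = tvec_add (chart_tvec M A c p a) (chart_tvec M A c p b)"
proof
  fix h
  show "chart_tvec M A c p (a + b) h = tvec_add (chart_tvec M A c p a) (chart_tvec M A c p b) h"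
    using linear_D[OF smooth_near_differentiable[OF assms]]
    by (cases "smooth_near M A p h")
      (simp_all add: tvec_add_def chart_tvec_apply chart_tvec_not_smooth linear_add)
qed

lemma chart_tvec_scale:
  assumes "c \<in> A" "p \<in> cdom c"
  shows "chart_tvec M A c p (r *\<^sub>R a) = tvec_scale r (chart_tvec M A c p a)"
proof
  fix h
  show "chart_tvec M A c p (r *\<^sub>R a) h = tvec_scale r (chart_tvec M A c p a) h"
    using linear_D[OF smooth_near_differentiable[OF assms]]
    by (cases "smooth_near M A p h")
      (simp_all add: tvec_scale_def chart_tvec_apply chart_tvec_not_smooth linear_cmul)
qed

section \<open>Smooth vector fields and their brackets\<close>

lemma smooth_vector_field_Cinf:
  assumes "smooth_vector_field M A X" "c \<in> A"
  shows "Cinf (cmap c ` cdom c) (\<lambda>y. component c i (X (cinv c y)))"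
  by (rule smooth_on_imp_Cinf[OF open_cmap_cdom[OF assms(2)]])
    (use assms in \<open>auto simp: smooth_vector_field_def\<close>)

lemma smooth_vector_field_tangent:
  "smooth_vector_field M A X \<Longrightarrow> p \<in> topspace M \<Longrightarrow> X p \<in> tangent_space M A p"
  by (simp add: smooth_vector_field_def)

lemma smooth_vector_fieldI:
  assumes "\<And>p. p \<in> topspace M \<Longrightarrow> X p \<in> tangent_space M A p"
    and "\<And>c i. c \<in> A \<Longrightarrow> Cinf (cmap c ` cdom c) (\<lambda>y. component c i (X (cinv c y)))"
  shows "smooth_vector_field M A X"
  unfolding smooth_vector_field_def
  using assms Cinf_imp_smooth_on[OF open_cmap_cdom] by blast

text \<open>In coordinates \<open>X(h)\<close> is a sum of components times partial derivatives.
  Smoothness of such functions is what allows a second tangent vector to act on them, as in a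
  commutator.\<close>

lemma Cinf_vector_field_apply:
  assumes X: "smooth_vector_field M A X" and c: "c \<in> A"
    and W: "openin M W" "W \<subseteq> cdom c" and h: "Cinf (cmap c ` W) (\<lambda>y. h (cinv c y))"
  shows "Cinf (cmap c ` W) (\<lambda>y. X (cinv c y) h)"
proof -
  let ?S = "cmap c ` W"
  have S: "open ?S" by (rule open_cmap_image'[OF c W])
  have "Cinf ?S (\<lambda>y. \<Sum>i\<in>UNIV. component c i (X (cinv c y)) * D (\<lambda>y. h (cinv c y)) y (axis i 1))"
    by (intro Cinf_sum Cinf_mult S Cinf_D h Cinf_subset[OF smooth_vector_field_Cinf[OF X c]])
      (use W in auto)
  then show ?thesis
  proof (rule Cinf_cong[OF S, rotated])
    fix y assume y: "y \<in> ?S"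
    then have q: "cinv c y \<in> W" "cinv c y \<in> cdom c" "cmap c (cinv c y) = y"
      using W c by auto
    have "smooth_near M A (cinv c y) h"
      using smooth_near_iff[OF c q(2)] W h q by blast
    from tangent_space_apply_sum[OF c q(2) _ this, of "X (cinv c y)"] q
    show "(\<Sum>i\<in>UNIV. component c i (X (cinv c y)) * D (\<lambda>y. h (cinv c y)) y (axis i 1)) = X (cinv c y) h"
      using smooth_vector_field_tangent[OF X] cdom_subset[OF c] by auto
  qed
qed

lemma smooth_near_vector_field_apply:
  assumes X: "smooth_vector_field M A X" and "p \<in> topspace M" "smooth_near M A p h"
  shows "smooth_near M A p (\<lambda>q. X q h)"
proof -
  obtain c where c: "c \<in> A" "p \<in> cdom c" using chart_around assms by blast
  then show ?thesis
    using assms Cinf_vector_field_apply[OF X c(1)] unfolding smooth_near_iff[OF c] by blast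
qed

text \<open>The second derivatives of the test function cancel in the commutator.\<close>

lemma lie_deriv_in_tangent_space:
  assumes X: "smooth_vector_field M A X" and Y: "smooth_vector_field M A Y" and p: "p \<in> topspace M"
  shows "lie_deriv M A X Y p \<in> tangent_space M A p"
proof -
  obtain c where c: "c \<in> A" "p \<in> cdom c" using chart_around p by blast
  define comp where "comp = (\<lambda>(Z :: 'a \<Rightarrow> 'a tvec) i y. component c i (Z (cinv c y)))"
  define vec where "vec = (\<lambda>Z :: 'a \<Rightarrow> 'a tvec. \<chi> i. comp Z i (cmap c p))"
  \<comment> \<open>The classical bracket components, where \<open>vec\<close> freezes the
    differentiating field at \<open>p\<close>.\<close>
  define b where "b = (\<chi> i. D (comp Y i) (cmap c p) (vec X) - D (comp X i) (cmap c p) (vec Y))"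
  have "lie_deriv M A X Y p h = chart_tvec M A c p b h" for h
  proof (cases "smooth_near M A p h")
    case True
    then obtain W where W: "openin M W" "p \<in> W" "W \<subseteq> cdom c"
      and h: "Cinf (cmap c ` W) (\<lambda>y. h (cinv c y))"
      unfolding smooth_near_iff[OF c] by blast
    let ?h = "\<lambda>y. h (cinv c y)" and ?y = "cmap c p"
    have S: "open (cmap c ` W)" "?y \<in> cmap c ` W"
      using open_cmap_image'[OF c(1) W(1,3)] W by auto
    have vec: "(\<chi> i. component c i (Z p)) = vec Z" for Z
      using c by (simp add: vec_def comp_def)
    have hd: "(\<lambda>y. D ?h y a) differentiable (at ?y)" for a
      using Cinf_differentiable[OF Cinf_D[OF h] S(2)] .
    \<comment> \<open>\<open>X(Y(h))\<close> is a first-order part plus the second derivative of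
      \<open>h\<close> in two directions frozen at \<open>p\<close>. The latter is symmetric in the
      two fields.\<close>
    have main: "X p (\<lambda>q. Y q h) = (\<Sum>i\<in>UNIV. D (comp Y i) ?y (vec X) * D ?h ?y (axis i 1))
        + D (\<lambda>y. D ?h y (vec X)) ?y (vec Y)"
      if X: "smooth_vector_field M A X" and Y: "smooth_vector_field M A Y" for X Y
    proof -
      have cd: "comp Y i differentiable (at ?y)" for i
        unfolding comp_def using Cinf_differentiable[OF smooth_vector_field_Cinf[OF Y c(1)]] c by blast
      have "X p (\<lambda>q. Y q h) = D (\<lambda>y. Y (cinv c y) h) ?y (vec X)"
        using tangent_space_apply[OF c smooth_vector_field_tangent[OF X p]
            smooth_near_vector_field_apply[OF Y p True]] vec by simp
      also have "\<dots> = D (\<lambda>y. \<Sum>i\<in>UNIV. comp Y i y * D ?h y (axis i 1)) ?y (vec X)"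
      proof (rule fun_cong[OF D_cong[OF S]])
        fix y assume "y \<in> cmap c ` W"
        then have q: "cinv c y \<in> W" "cinv c y \<in> cdom c" "cmap c (cinv c y) = y"
          using W c by auto
        have "smooth_near M A (cinv c y) h"
          using smooth_near_iff[OF c(1) q(2)] W h q by blast
        from tangent_space_apply_sum[OF c(1) q(2) _ this, of "Y (cinv c y)"] q
        show "Y (cinv c y) h = (\<Sum>i\<in>UNIV. comp Y i y * D ?h y (axis i 1))"
          using smooth_vector_field_tangent[OF Y] cdom_subset[OF c(1)] by (auto simp: comp_def)
      qed
      also have "\<dots> = (\<Sum>i\<in>UNIV. D (comp Y i) ?y (vec X) * D ?h ?y (axis i 1))
          + (\<Sum>i\<in>UNIV. vec Y $ i * D (\<lambda>y. D ?h y (axis i 1)) ?y (vec X))"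
        by (simp add: D_sum D_mult cd hd sum.distrib vec_def)
      also have "(\<Sum>i\<in>UNIV. vec Y $ i * D (\<lambda>y. D ?h y (axis i 1)) ?y (vec X)) =
          (\<Sum>i\<in>UNIV. vec Y $ i * D (\<lambda>y. D ?h y (vec X)) ?y (axis i 1))"
        by (subst symmetric_D[OF S h]) (rule refl)
      also have "(\<Sum>i\<in>UNIV. vec Y $ i * D (\<lambda>y. D ?h y (vec X)) ?y (axis i 1)) = D (\<lambda>y. D ?h y (vec X)) ?y (vec Y)"
        by (rule D_axis[OF hd, symmetric])
      finally show ?thesis .
    qed
    have "D (\<lambda>y. D ?h y (vec X)) ?y (vec Y) = D (\<lambda>y. D ?h y (vec Y)) ?y (vec X)"
      by (rule symmetric_D[OF S h])
    then have "lie_deriv M A X Y p h = (\<Sum>i\<in>UNIV. b $ i * D ?h ?y (axis i 1))"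
      using True main[OF X Y] main[OF Y X]
      by (simp add: lie_deriv_def b_def left_diff_distrib sum_subtractf)
    also have "\<dots> = chart_tvec M A c p b h"
      unfolding chart_tvec_apply[OF True]
      by (rule D_axis[OF smooth_near_differentiable[OF c True], symmetric])
    finally show ?thesis .
  qed (simp add: lie_deriv_def chart_tvec_not_smooth)
  then have "lie_deriv M A X Y p = chart_tvec M A c p b" by blast
  then show ?thesis using c by simp
qed

section \<open>Vector fields depending on a parameter\<close>

definition field_coord :: "('a, 'n) chart \<Rightarrow> (real \<Rightarrow> 'a \<Rightarrow> 'a tvec) \<Rightarrow> 'n \<Rightarrow> real \<times> (real ^ 'n) \<Rightarrow> real" where
  "field_coord c f i z = component c i (f (fst z) (cinv c (snd z)))"

lemma component_tvec_scale: "component c i (tvec_scale r v) = r * component c i v"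
  by (simp add: component_def tvec_scale_def)

lemma tvec_scale_in_tangent_space:
  assumes "p \<in> topspace M" "v \<in> tangent_space M A p"
  shows "tvec_scale r v \<in> tangent_space M A p"
proof -
  obtain c where c: "c \<in> A" "p \<in> cdom c" using chart_around assms(1) by blast
  then show ?thesis
    using chart_tvec_scale[OF c, of r "\<chi> i. component c i v"] tangent_space_chart[OF c assms(2)]
      chart_tvec_in_tangent_space[OF c, of "r *\<^sub>R (\<chi> i. component c i v)"] by simp
qed

lemma Cinf_smooth_param_fun:
  assumes "smooth_param_fun A T u" "c \<in> A" "t \<in> T"
  shows "Cinf (cmap c ` cdom c) (\<lambda>y. u t (cinv c y))"
  using Cinf_slice[OF open_cmap_cdom[OF assms(2)], of T "\<lambda>(t, y). u t (cinv c y)" t] assms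
  by (simp add: smooth_param_fun_def)

context
  fixes f :: "real \<Rightarrow> 'a \<Rightarrow> 'a tvec"
  assumes f: "smooth_param_vector_field M A f"
begin

lemma Cinf_field_coord:
  assumes "c \<in> A"
  shows "Cinf (UNIV \<times> cmap c ` cdom c) (field_coord c f i)"
proof -
  have "field_coord c f i = (\<lambda>(s, y). component c i (f s (cinv c y)))"
    by (auto simp: field_coord_def fun_eq_iff)
  then show ?thesis
    using f assms open_cmap_cdom[OF assms]
    by (auto intro!: smooth_on_imp_Cinf open_Times simp: smooth_param_vector_field_def)
qed

lemma differentiable_field_coord:
  "c \<in> A \<Longrightarrow> p \<in> cdom c \<Longrightarrow> field_coord c f i differentiable (at (s, cmap c p))"
  by (rule Cinf_differentiable[OF Cinf_field_coord]) auto

lemma param_field_tangent: "p \<in> topspace M \<Longrightarrow> f s p \<in> tangent_space M A p"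
  using f by (simp add: smooth_param_vector_field_def)

lemma component_param_deriv:
  assumes c: "c \<in> A" "p \<in> cdom c"
  shows "component c i (param_deriv f s p) = D (field_coord c f i) (s, cmap c p) (1, 0)"
  using DERIV_imp_deriv[OF has_real_derivative_param[OF differentiable_field_coord[OF c]]] c
  by (simp add: field_coord_def component_def param_deriv_def)

text \<open>\<open>param_deriv\<close> differentiates separately for each test function. In a fixed
  chart the value of \<open>f r p\<close> on \<open>h\<close> is a combination of partial
  derivatives of \<open>h\<close> that are independent of \<open>r\<close>, so differentiation acts
  on the components. For \<open>h\<close> not smooth near \<open>p\<close> the differentiated
  function is constantly \<open>0\<close>.\<close>

lemma param_deriv_in_tangent_space:
  assumes p: "p \<in> topspace M"
  shows "param_deriv f s p \<in> tangent_space M A p"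
proof -
  obtain c where c: "c \<in> A" "p \<in> cdom c" using chart_around p by blast
  let ?a = "\<chi> i. D (field_coord c f i) (s, cmap c p) (1, 0)"
  have "param_deriv f s p h = chart_tvec M A c p ?a h" for h
  proof (cases "smooth_near M A p h")
    case True
    let ?h = "\<lambda>i. D (\<lambda>y. h (cinv c y)) (cmap c p) (axis i 1)"
    have "f r p h = (\<Sum>i\<in>UNIV. field_coord c f i (r, cmap c p) * ?h i)" for r
      using tangent_space_apply_sum[OF c param_field_tangent[OF p] True] c
      by (simp add: field_coord_def)
    moreover have "((\<lambda>r. \<Sum>i\<in>UNIV. field_coord c f i (r, cmap c p) * ?h i) has_real_derivative
        (\<Sum>i\<in>UNIV. D (field_coord c f i) (s, cmap c p) (1, 0) * ?h i)) (at s)"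
      by (intro DERIV_sum DERIV_cmult_right has_real_derivative_param differentiable_field_coord c)
    ultimately have "param_deriv f s p h = (\<Sum>i\<in>UNIV. ?a $ i * ?h i)"
      unfolding param_deriv_def by (simp add: DERIV_imp_deriv)
    also have "\<dots> = chart_tvec M A c p ?a h"
      unfolding chart_tvec_apply[OF True]
      by (rule D_axis[OF smooth_near_differentiable[OF c True], symmetric])
    finally show ?thesis .
  next
    case False
    then show ?thesis
      by (simp add: param_deriv_def tangent_space_not_smooth[OF param_field_tangent[OF p]] chart_tvec_not_smooth)
  qed
  then have "param_deriv f s p = chart_tvec M A c p ?a" by blast
  then show ?thesis using c by simp
qed

context
  fixes v :: "'a \<Rightarrow> real"
  assumes v: "\<And>c. c \<in> A \<Longrightarrow> Cinf (cmap c ` cdom c) (\<lambda>y. v (cinv c y))"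
begin

lemma Cinf_along_graph:
  assumes c: "c \<in> A" and G: "Cinf (UNIV \<times> cmap c ` cdom c) G"
  shows "Cinf (cmap c ` cdom c) (\<lambda>y. G (v (cinv c y), y) :: real)"
  by (rule Cinf_compose[OF open_cmap_cdom[OF c] G])
    (use v[OF c] open_cmap_cdom[OF c] in \<open>auto intro!: Cinf_Pair Cinf_id\<close>)

lemma smooth_vector_field_along_graph: "smooth_vector_field M A (\<lambda>q. f (v q) q)"
proof (rule smooth_vector_fieldI)
  fix c i assume c: "c \<in> A"
  show "Cinf (cmap c ` cdom c) (\<lambda>y. component c i (f (v (cinv c y)) (cinv c y)))"
    using Cinf_along_graph[OF c Cinf_field_coord[OF c]] by (simp add: field_coord_def)
qed (rule param_field_tangent)

lemma smooth_vector_field_scaled_param_deriv: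
  assumes w: "\<And>c. c \<in> A \<Longrightarrow> Cinf (cmap c ` cdom c) (\<lambda>y. w (cinv c y))"
  shows "smooth_vector_field M A (\<lambda>q. tvec_scale (w q) (param_deriv f (v q) q))"
proof (rule smooth_vector_fieldI)
  fix c i assume c: "c \<in> A"
  have o: "open (cmap c ` cdom c)" by (rule open_cmap_cdom[OF c])
  have "Cinf (cmap c ` cdom c) (\<lambda>y. w (cinv c y) * D (field_coord c f i) (v (cinv c y), y) (1, 0))"
    by (intro Cinf_mult o w c Cinf_along_graph Cinf_D Cinf_field_coord)
  then show "Cinf (cmap c ` cdom c)
      (\<lambda>y. component c i (tvec_scale (w (cinv c y)) (param_deriv f (v (cinv c y)) (cinv c y))))"
    by (rule Cinf_cong[OF o, rotated])
      (simp add: component_tvec_scale component_param_deriv[OF c cinv_in])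
qed (intro tvec_scale_in_tangent_space param_deriv_in_tangent_space)

end

lemma smooth_vector_field_fixed_param: "smooth_vector_field M A (f s)"
  using smooth_vector_field_along_graph[of "\<lambda>_. s"] Cinf_const open_cmap_cdom by blast

lemma smooth_vector_field_param_deriv: "smooth_vector_field M A (param_deriv f s)"
  using smooth_vector_field_scaled_param_deriv[of "\<lambda>_. s" "\<lambda>_. 1",
      OF Cinf_const[OF open_cmap_cdom] Cinf_const[OF open_cmap_cdom]]
  by (simp add: tvec_scale_def)

end

end


locale riemannian_mfd = smooth_mfd M A
  for M :: "'a topology" and A :: "('a, 'n::finite) chart set" +
  fixes g :: "'a metric"
  assumes metric: "riemannian_metric M A g"
begin

section \<open>The metric in coordinates and the gradient\<close>

lemma metric_commute:
  "p \<in> topspace M \<Longrightarrow> v \<in> tangent_space M A p \<Longrightarrow> w \<in> tangent_space M A p \<Longrightarrow> g p v w = g p w v"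
  using metric by (simp add: riemannian_metric_def)

lemma linear_metric:
  assumes c: "c \<in> A" "p \<in> cdom c" and w: "w \<in> tangent_space M A p"
  shows "linear (\<lambda>a. g p (chart_tvec M A c p a) w)"
proof
  have p: "p \<in> topspace M" using c cdom_subset by blast
  note T = chart_tvec_in_tangent_space[OF c]
  fix a b r
  show "g p (chart_tvec M A c p (a + b)) w = g p (chart_tvec M A c p a) w + g p (chart_tvec M A c p b) w"
    using metric p w T by (simp add: chart_tvec_add[OF c] riemannian_metric_def)
  show "g p (chart_tvec M A c p (r *\<^sub>R a)) w = r *\<^sub>R g p (chart_tvec M A c p a) w"
    using metric p w T by (simp add: chart_tvec_scale[OF c] riemannian_metric_def)
qed

lemma metric_sum_left:
  assumes c: "c \<in> A" "p \<in> cdom c" and w: "w \<in> tangent_space M A p"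
  shows "g p (chart_tvec M A c p a) w = (\<Sum>i\<in>UNIV. a $ i * g p (chart_basis M A c p i) w)"
proof -
  have "g p (chart_tvec M A c p a) w = g p (chart_tvec M A c p (\<Sum>i\<in>UNIV. a $ i *\<^sub>R axis i 1)) w"
    using basis_expansion[of a] by (simp add: scalar_mult_eq_scaleR)
  also have "\<dots> = (\<Sum>i\<in>UNIV. a $ i * g p (chart_basis M A c p i) w)"
    using linear_sum[OF linear_metric[OF assms], of "\<lambda>i. a $ i *\<^sub>R axis i 1" UNIV]
      linear_cmul[OF linear_metric[OF assms]]
    by (simp add: chart_basis_def)
  finally show ?thesis .
qed

lemma metric_sum_right:
  assumes c: "c \<in> A" "p \<in> cdom c" and v: "v \<in> tangent_space M A p"
  shows "g p v (chart_tvec M A c p b) = (\<Sum>j\<in>UNIV. b $ j * g p v (chart_basis M A c p j))"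
proof -
  have p: "p \<in> topspace M" using c cdom_subset by blast
  have "g p v (chart_tvec M A c p b) = (\<Sum>j\<in>UNIV. b $ j * g p (chart_basis M A c p j) v)"
    using metric_sum_left[OF c v, of b] metric_commute[OF p v] c by simp
  then show ?thesis
    using metric_commute[OF p v] c by (simp add: chart_basis_def)
qed

lemma metric_gram:
  assumes c: "c \<in> A" "p \<in> cdom c"
  shows "g p (chart_tvec M A c p a) (chart_tvec M A c p b) = a \<bullet> (gram M A g c p *v b)"
proof -
  have T: "chart_basis M A c p i \<in> tangent_space M A p" for i
    using c by (simp add: chart_basis_def)
  have "g p (chart_tvec M A c p a) (chart_tvec M A c p b) =
      (\<Sum>i\<in>UNIV. a $ i * (\<Sum>j\<in>UNIV. b $ j * g p (chart_basis M A c p i) (chart_basis M A c p j)))"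
    unfolding metric_sum_left[OF c chart_tvec_in_tangent_space[OF c]] metric_sum_right[OF c T] ..
  then show ?thesis
    by (simp add: inner_vec_def matrix_vector_mult_def gram_def mult.commute)
qed

text \<open>A kernel vector of the Gram matrix represents a tangent vector of length zero, hence the
  zero operator by definiteness. Its components, being values on coordinate functions, then vanish
  too.\<close>

lemma gram_nonsingular:
  assumes c: "c \<in> A" "p \<in> cdom c"
  shows "det (gram M A g c p) \<noteq> 0"
proof
  assume "det (gram M A g c p) = 0"
  then have "\<not> invertible (gram M A g c p)" by (simp add: invertible_det_nz)
  then obtain a where a: "gram M A g c p *v a = 0" "a \<noteq> 0"
    using invertible_left_inverse matrix_left_invertible_ker by blast
  have "g p (chart_tvec M A c p a) (chart_tvec M A c p a) = 0"
    by (simp add: metric_gram[OF c] a)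
  then have "chart_tvec M A c p a = (\<lambda>h. 0)"
    using metric c cdom_subset[OF c(1)] chart_tvec_in_tangent_space[OF c]
    unfolding riemannian_metric_def by (metis less_irrefl subsetD)
  then have "component c i (chart_tvec M A c p a) = 0" for i
    by (simp add: component_def)
  then show False using a c by (simp add: vec_eq_iff)
qed

text \<open>The inverse Gram matrix raises the index of the differential of \<open>h\<close>. The
  difference of two solutions is orthogonal to all tangent vectors, so the Gram matrix annihilates
  its components.\<close>

lemma grad_ex1:
  assumes p: "p \<in> topspace M" and h: "smooth_near M A p h"
  shows "\<exists>!v. v \<in> tangent_space M A p \<and> (\<forall>w\<in>tangent_space M A p. g p v w = w h)"
proof -
  obtain c where c: "c \<in> A" "p \<in> cdom c" using chart_around p by blast
  let ?G = "gram M A g c p" and ?b = "\<chi> i. chart_basis M A c p i h"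
  obtain B where B: "?G ** B = mat 1"
    using gram_nonsingular[OF c] invertible_det_nz[of ?G] by (auto simp: invertible_def)
  let ?v = "chart_tvec M A c p (B *v ?b)"
  have rep: "\<exists>a. w = chart_tvec M A c p a" if "w \<in> tangent_space M A p" for w
    using tangent_space_chart[OF c that] by blast
  have "g p ?v w = w h" if w: "w \<in> tangent_space M A p" for w
  proof -
    obtain a where a: "w = chart_tvec M A c p a" using rep[OF w] by blast
    have "g p ?v w = g p w ?v" using metric_commute[OF p _ w] c by simp
    also have "\<dots> = a \<bullet> ?b"
      using B by (simp add: a metric_gram[OF c] matrix_vector_mul_assoc)
    also have "\<dots> = w h"
      unfolding a chart_tvec_apply[OF h]
      by (subst D_axis[OF smooth_near_differentiable[OF c h]])
        (simp add: inner_vec_def chart_basis_def chart_tvec_apply[OF h])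
    finally show ?thesis .
  qed
  then have ex: "?v \<in> tangent_space M A p \<and> (\<forall>w\<in>tangent_space M A p. g p ?v w = w h)"
    using c by simp
  show ?thesis
  proof (rule ex1I[where a = ?v])
    show "?v \<in> tangent_space M A p \<and> (\<forall>w\<in>tangent_space M A p. g p ?v w = w h)" by (rule ex)
    fix v assume v: "v \<in> tangent_space M A p \<and> (\<forall>w\<in>tangent_space M A p. g p v w = w h)"
    obtain a where a: "v = chart_tvec M A c p a" using rep v by blast
    let ?d = "a - B *v ?b"
    have "g p (chart_tvec M A c p ?d) (chart_tvec M A c p x) = 0" for x
      using linear_diff[OF linear_metric[OF c chart_tvec_in_tangent_space[OF c]], of a "B *v ?b" x]
        ex v c unfolding a by simp
    then have "x \<bullet> (?G *v ?d) = 0" for x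
      unfolding metric_gram[OF c, symmetric]
      by (subst metric_commute[OF p chart_tvec_in_tangent_space[OF c] chart_tvec_in_tangent_space[OF c]])
    then have "?G *v ?d = 0" using inner_eq_zero_iff by blast
    moreover have "B ** ?G = mat 1" using B matrix_left_right_inverse by blast
    ultimately have "?d = 0" by (metis matrix_vector_mul_assoc matrix_vector_mul_lid matrix_vector_mult_0_right)
    then show "v = ?v" using a by simp
  qed
qed

lemma metric_grad:
  assumes "p \<in> topspace M" "smooth_near M A p h" "w \<in> tangent_space M A p"
  shows "g p (grad M A g h p) w = w h"
  using theI'[OF grad_ex1[OF assms(1,2)]] assms(3) unfolding grad_def by blast

section \<open>The Gram determinant and independence of the divergence of the chart\<close>

definition gram_det :: "('a, 'n) chart \<Rightarrow> real ^ 'n \<Rightarrow> real" where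
  "gram_det c y = det (gram M A g c (cinv c y))"

lemma Cinf_gram_det:
  assumes "c \<in> A"
  shows "Cinf (cmap c ` cdom c) (gram_det c)"
proof -
  have o: "open (cmap c ` cdom c)" by (rule open_cmap_cdom[OF assms])
  have "smooth_on (cmap c ` cdom c) (\<lambda>y. gram M A g c (cinv c y) $ i $ j)" for i j
    using metric assms by (simp add: riemannian_metric_def)
  then show ?thesis
    unfolding gram_det_def[abs_def] by (intro Cinf_det[OF o] smooth_on_imp_Cinf[OF o])
qed

lemma gram_det_nonzero: "c \<in> A \<Longrightarrow> y \<in> cmap c ` cdom c \<Longrightarrow> gram_det c y \<noteq> 0"
  unfolding gram_det_def by (intro gram_nonsingular cinv_in)

text \<open>The columns of \<open>J\<close> are the coordinate basis vectors of \<open>c\<close>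
  written in \<open>c'\<close>, so the two Gram matrices are congruent through
  \<open>J\<close>.\<close>

lemma det_gram_change:
  assumes c: "c \<in> A" "p \<in> cdom c" and c': "c' \<in> A" "p \<in> cdom c'"
    and J: "J = (\<chi> k j. D (\<lambda>y. cmap c' (cinv c y) $ k) (cmap c p) (axis j 1))"
  shows "det (gram M A g c p) = det (gram M A g c' p) * (det J)\<^sup>2"
proof -
  let ?S = "cmap c ` (cdom c \<inter> cdom c')"
  have d: "(\<lambda>y. cmap c' (cinv c y)) differentiable (at (cmap c p))"
    by (rule Cinf_differentiable[OF Cinf_transition[OF c(1) c'(1)]]) (use c c' in auto)
  have col: "D (\<lambda>y. cmap c' (cinv c y)) (cmap c p) (axis j 1) = column j J" for j
    using D_bounded_linear[OF bounded_linear_vec_nth d]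
    by (simp add: vec_eq_iff J column_def)
  have "gram M A g c p = transpose J ** (gram M A g c' p ** J)"
  proof -
    have "gram M A g c p $ i $ j = column i J \<bullet> (gram M A g c' p *v column j J)" for i j
      by (simp add: gram_def[of M A g c] chart_basis_def chart_tvec_change[OF c c'] col metric_gram[OF c'])
    then show ?thesis
      by (simp add: vec_eq_iff inner_vec_def matrix_matrix_mult_def matrix_vector_mult_def
          column_def transpose_def)
  qed
  then show ?thesis by (simp add: det_mul power2_eq_square)
qed

text \<open>\<open>chart_basis\<close> acts as a partial derivative only on functions smooth near
  \<open>p\<close>. The weighted components qualify because the Gram determinant is smooth and
  nonzero.\<close>

lemma chart_divergence_coords:
  assumes V: "smooth_vector_field M A V" and c: "c \<in> A" "p \<in> cdom c"
  shows "chart_divergence M A g c V p = coord_div (gram_det c) (\<lambda>i y. component c i (V (cinv c y))) (cmap c p)"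
proof -
  have o: "open (cmap c ` cdom c)" by (rule open_cmap_cdom[OF c(1)])
  have "smooth_near M A p (\<lambda>q. sqrt (det (gram M A g c q)) * component c i (V q))" for i
    by (rule smooth_near_cdomI[OF c], fold gram_det_def)
      (intro Cinf_mult Cinf_sqrt o Cinf_gram_det smooth_vector_field_Cinf V c gram_det_nonzero)
  then show ?thesis
    using c by (simp add: chart_divergence_def coord_div_def chart_basis_def chart_tvec_apply gram_det_def)
qed

lemma chart_divergence_change:
  assumes V: "smooth_vector_field M A V" and c: "c \<in> A" "p \<in> cdom c" and c': "c' \<in> A" "p \<in> cdom c'"
  shows "chart_divergence M A g c V p = chart_divergence M A g c' V p"
proof -
  let ?N = "cmap c ` (cdom c \<inter> cdom c')" and ?\<phi> = "\<lambda>y. cmap c' (cinv c y)" and ?\<psi> = "\<lambda>y. cmap c (cinv c' y)"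
  let ?J = "\<lambda>z. (\<chi> k j. D (\<lambda>y. ?\<phi> y $ k) z (axis j 1)) :: real ^ 'n ^ 'n"
  \<comment> \<open>The Jacobian of the inverse transition map. By the chain rule it is the inverse
    matrix required for the change of variables.\<close>
  define C where "C = ((\<chi> k j. D (\<lambda>y. ?\<psi> y $ k) (cmap c' p) (axis j 1)) :: real ^ 'n ^ 'n)"
  let ?N' = "cmap c' ` (cdom c' \<inter> cdom c)"
  have N: "open ?N" "cmap c p \<in> ?N"
    using open_cmap_image[OF c(1) openin_cdom[OF c'(1)]] c c' by auto
  have N': "open ?N'" "cmap c' p \<in> ?N'"
    using open_cmap_image[OF c'(1) openin_cdom[OF c(1)]] c c' by auto
  have \<phi>: "Cinf ?N ?\<phi>" and \<psi>: "Cinf ?N' ?\<psi>"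
    using Cinf_transition c c' by auto
  have \<phi>k: "(\<lambda>y. ?\<phi> y $ k) differentiable (at z)" if "z \<in> ?N" for z k
    by (rule Cinf_differentiable[OF Cinf_bounded_linear[OF N(1) bounded_linear_vec_nth \<phi>] that])
  have \<psi>d: "?\<psi> differentiable (at (cmap c' p))"
    by (rule Cinf_differentiable[OF \<psi> N'(2)])
  have C: "?J (cmap c p) ** C = mat 1"
  proof -
    have "(?J (cmap c p) ** C) $ k $ l = mat 1 $ k $ l" for k l
    proof -
      have "(?J (cmap c p) ** C) $ k $ l =
          (\<Sum>i\<in>UNIV. D ?\<psi> (cmap c' p) (axis l 1) $ i * D (\<lambda>y. ?\<phi> y $ k) (cmap c p) (axis i 1))"
        using D_bounded_linear[OF bounded_linear_vec_nth \<psi>d]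
        by (simp add: matrix_matrix_mult_def C_def mult.commute)
      also have "\<dots> = D (\<lambda>y. ?\<phi> y $ k) (cmap c p) (D ?\<psi> (cmap c' p) (axis l 1))"
        by (rule D_axis[OF \<phi>k[OF N(2)], symmetric])
      also have "\<dots> = D (\<lambda>y. ?\<phi> (?\<psi> y) $ k) (cmap c' p) (axis l 1)"
        using D_compose[of "\<lambda>y. ?\<phi> y $ k" ?\<psi> "cmap c' p" "axis l 1"] \<phi>k[OF N(2)] \<psi>d c' by simp
      also have "\<dots> = D (\<lambda>y. y $ k) (cmap c' p) (axis l 1)"
        by (rule fun_cong[OF D_cong[OF N']]) (use c c' in auto)
      also have "\<dots> = axis l 1 $ k"
        by (rule D_eqI) (rule bounded_linear_imp_has_derivative[OF bounded_linear_vec_nth])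
      finally show ?thesis by (simp add: mat_def axis_def)
    qed
    then show ?thesis by (simp add: vec_eq_iff)
  qed
  have im: "cmap c p \<in> cmap c ` cdom c" "cmap c' p \<in> cmap c' ` cdom c'" using c c' by auto
  have "coord_div (gram_det c) (\<lambda>i y. component c i (V (cinv c y))) (cmap c p) =
      coord_div (gram_det c') (\<lambda>i y. component c' i (V (cinv c' y))) (?\<phi> (cmap c p))"
  proof (rule coord_div_change[OF N \<phi> C])
    show "gram_det c differentiable (at (cmap c p))" "gram_det c (cmap c p) \<noteq> 0"
      "\<And>i. (\<lambda>y. component c i (V (cinv c y))) differentiable (at (cmap c p))"
      using Cinf_differentiable[OF Cinf_gram_det[OF c(1)] im(1)] gram_det_nonzero[OF c(1) im(1)]
        Cinf_differentiable[OF smooth_vector_field_Cinf[OF V c(1)] im(1)] by auto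
    show "gram_det c' differentiable (at (?\<phi> (cmap c p)))" "gram_det c' (?\<phi> (cmap c p)) \<noteq> 0"
      "\<And>i. (\<lambda>y. component c' i (V (cinv c' y))) differentiable (at (?\<phi> (cmap c p)))"
      using Cinf_differentiable[OF Cinf_gram_det[OF c'(1)] im(2)] gram_det_nonzero[OF c'(1) im(2)]
        Cinf_differentiable[OF smooth_vector_field_Cinf[OF V c'(1)] im(2)] c by auto
    fix z assume z: "z \<in> ?N"
    then obtain q where q: "q \<in> cdom c" "q \<in> cdom c'" "z = cmap c q" by auto
    show "gram_det c z = gram_det c' (?\<phi> z) * (det (?J z))\<^sup>2"
      using det_gram_change[OF c(1) q(1) c'(1) q(2) refl] q c c' by (simp add: gram_det_def)
    fix k
    have Vq: "V q \<in> tangent_space M A q"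
      using smooth_vector_field_tangent[OF V] cdom_subset[OF c(1)] q by blast
    have dz: "?\<phi> differentiable (at z)" by (rule Cinf_differentiable[OF \<phi> z])
    have "V q = chart_tvec M A c' q (D ?\<phi> z (\<chi> i. component c i (V q)))"
      unfolding q(3)
      by (rule trans[OF tangent_space_chart[OF c(1) q(1) Vq] chart_tvec_change[OF c(1) q(1) c'(1) q(2)]])
    then have "component c' k (V q) = component c' k (chart_tvec M A c' q (D ?\<phi> z (\<chi> i. component c i (V q))))"
      by (rule arg_cong)
    also have "\<dots> = D ?\<phi> z (\<chi> i. component c i (V q)) $ k"
      by (rule component_chart_tvec[OF c'(1) q(2)])
    also have "\<dots> = D (\<lambda>y. ?\<phi> y $ k) z (\<chi> i. component c i (V q))"
      by (rule D_bounded_linear[OF bounded_linear_vec_nth dz, symmetric])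
    also have "\<dots> = (\<Sum>j\<in>UNIV. ?J z $ k $ j * component c j (V q))"
      by (subst D_axis[OF \<phi>k[OF z]]) (simp add: mult.commute)
    finally show "component c' k (V (cinv c' (?\<phi> z))) = (\<Sum>j\<in>UNIV. ?J z $ k $ j * component c j (V (cinv c z)))"
      using q c c' by simp
  qed
  then show ?thesis
    using c by (simp add: chart_divergence_coords[OF V c] chart_divergence_coords[OF V c'])
qed

text \<open>All charts around \<open>p\<close> give the same value, which yields existence for the
  definite description. The chart \<open>c\<close> is one of them, which yields uniqueness.\<close>

lemma divergence_coords:
  assumes V: "smooth_vector_field M A V" and c: "c \<in> A" "p \<in> cdom c"
  shows "divergence M A g V p = coord_div (gram_det c) (\<lambda>i y. component c i (V (cinv c y))) (cmap c p)"
proof -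
  have "divergence M A g V p = chart_divergence M A g c V p"
    unfolding divergence_def
  proof (rule the_equality)
    show "\<forall>c'\<in>A. p \<in> cdom c' \<longrightarrow> chart_divergence M A g c' V p = chart_divergence M A g c V p"
      using chart_divergence_change[OF V _ _ c] by blast
  qed (use c in blast)
  then show ?thesis by (simp add: chart_divergence_coords[OF assms])
qed

end


section \<open>Differentiating the conservation law\<close>

theorem proposition2p1:
  fixes M :: "'a topology"
    and A :: "('a, 'n::finite) chart set"
    and g :: "'a metric"
    and f :: "real \<Rightarrow> 'a \<Rightarrow> 'a tvec"
    and u :: "real \<Rightarrow> 'a \<Rightarrow> real"
    and X :: "'a \<Rightarrow> 'a tvec"
    and w :: "real \<Rightarrow> 'a \<Rightarrow> real"
  assumes "smooth_manifold M A"
    and "riemannian_metric M A g"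
    and "smooth_param_vector_field M A f"
    and "smooth_param_fun A {0..} u"
    and "\<forall>t\<ge>0. \<forall>p\<in>topspace M.
           time_deriv u t p + divergence M A g (\<lambda>q. f (u t q) q) p = 0"
    and "smooth_vector_field M A X"
    and "\<forall>t\<ge>0. \<forall>p\<in>topspace M. w t p = X p (u t)"
  shows "\<forall>t\<ge>0. \<forall>p\<in>topspace M.
           time_deriv w t p
             + divergence M A g (\<lambda>q. tvec_scale (w t q) (param_deriv f (u t q) q)) p
           = - g p (grad M A g (u t) p) (lie_deriv M A X (param_deriv f (u t p)) p)
             - X p (\<lambda>q. divergence M A g (f (u t p)) q)"
proof (intro allI impI ballI)
  fix t :: real and p assume t: "0 \<le> t" and p: "p \<in> topspace M"
  interpret riemannian_mfd M A g by unfold_locales (fact assms(1,2))+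
  note f = assms(3) and X = assms(6)
  have uC: "Cinf (cmap c ` cdom c) (\<lambda>y. u r (cinv c y))" if "c \<in> A" "0 \<le> r" for c r
    using Cinf_smooth_param_fun[OF assms(4) that(1)] that(2) by simp
  have w: "w r q = X q (u r)" if "0 \<le> r" "q \<in> topspace M" for r q
    using assms(7) that by blast
  \<comment> \<open>\<open>w\<close> is prescribed on the manifold only; chart domains lie inside
    it, so \<open>w t\<close> inherits the smoothness of \<open>X q (u t)\<close>.\<close>
  have wC: "Cinf (cmap c ` cdom c) (\<lambda>y. w t (cinv c y))" if c: "c \<in> A" for c
    by (rule Cinf_cong[OF open_cmap_cdom[OF c] _
          Cinf_vector_field_apply[OF X c openin_cdom[OF c] order_refl uC[OF c t]]])
      (use w[OF t] cdom_subset[OF c] c in auto)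
  have u_near: "smooth_near M A q (u r)" if "0 \<le> r" "q \<in> topspace M" for r q
    using chart_around[OF that(2)] smooth_near_cdomI uC that(1) by metis

  obtain c where c: "c \<in> A" "p \<in> cdom c" using chart_around p by blast
  define U where "U = cmap c ` cdom c"
  define y where "y = cmap c p"
  define x where "x = (\<chi> i. component c i (X p))"
  have U: "open U" "y \<in> U" using open_cmap_cdom c by (auto simp: U_def y_def)
  have chart: "cinv c z \<in> cdom c" "cinv c z \<in> topspace M" "cmap c (cinv c z) = z" if "z \<in> U" for z
    using that c cdom_subset[OF c(1)] by (auto simp: U_def)
  have cinv_y: "cinv c y = p" using c by (simp add: y_def)
  have X_apply: "X p h = D (\<lambda>y. h (cinv c y)) y x" if "smooth_near M A p h" for h
    using tangent_space_apply[OF c smooth_vector_field_tangent[OF X p] that] by (simp add: x_def y_def)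

  have "smooth_on ({0..} \<times> U) (\<lambda>(t, y). u t (cinv c y))"
    using assms(4) c by (simp add: smooth_param_fun_def U_def)
  moreover have "(t, y) \<in> {0..} \<times> U" using t U by simp
  \<comment> \<open>\<open>F\<close> continues the chart expression of \<open>u\<close> to an open
    neighbourhood of \<open>(t, y)\<close>, for \<open>t = 0\<close> also to negative times. It is
    compared with \<open>u\<close> only at nonnegative times.\<close>
  ultimately obtain N F where N: "open N" "(t, y) \<in> N" "\<And>k. Ck_on k F N"
    and F: "\<And>z. z \<in> N \<inter> ({0..} \<times> U) \<Longrightarrow> F z = (\<lambda>(t, y). u t (cinv c y)) z"
    unfolding smooth_on_def by metis
  obtain I B' where IB': "open I" "t \<in> I" "open B'" "y \<in> B'" "I \<times> B' \<subseteq> N"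
    using open_prod_elim[OF N(1,2)] by (metis mem_Sigma_iff)
  define B where "B = B' \<inter> U"
  have I: "open I" "t \<in> I" and B: "open B" "y \<in> B" and BU: "B \<subseteq> U"
    using IB' U by (auto simp: B_def)
  have FC: "Cinf (I \<times> B) F"
    by (rule Cinf_subset[of N]) (use N IB' in \<open>auto simp: Cinf_def B_def\<close>)
  have Fu: "F (r, z) = u r (cinv c z)" if "r \<in> I" "0 \<le> r" "z \<in> B" for r z
    using F[of "(r, z)"] IB' that by (auto simp: B_def)
  have Fd: "F differentiable (at (r, z))" if "r \<in> I" "z \<in> B" for r z
    using Cinf_differentiable[OF FC] that by blast
  define v where "v = (\<lambda>y. F (t, y))"
  define W where "W = (\<lambda>y. w t (cinv c y))"
  have v: "v z = u t (cinv c z)" if "z \<in> B" for z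
    using Fu I t that by (simp add: v_def)
  have vy: "v y = u t p" using v B cinv_y by simp
  have Dv: "D (\<lambda>y. u t (cinv c y)) z = D v z" if "z \<in> B" for z
    by (rule D_cong[OF B(1) that]) (simp add: v)
  let ?fs = "\<lambda>i z. D (field_coord c f i) z (1, 0)"
  let ?Y = "param_deriv f (u t p)"
  have Y: "smooth_vector_field M A ?Y" by (rule smooth_vector_field_param_deriv[OF f])
  have Yc: "component c i (?Y (cinv c z)) = ?fs i (v y, z)" if "z \<in> B" for i z
    using component_param_deriv[OF f c(1) chart(1)] chart(3) that BU vy by auto

  have law: "D F (t, z) (1, 0) + coord_div (gram_det c) (\<lambda>i y. field_coord c f i (v y, y)) z = 0"
    if z: "z \<in> B" for z
  proof -
    have zU: "z \<in> U" using z BU by blast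
    have "time_deriv u t (cinv c z) = D F (t, z) (1, 0)"
      by (rule time_deriv_eq[OF I t _ has_real_derivative_param[OF Fd[OF I(2) z]]]) (simp add: Fu z)
    moreover have "divergence M A g (\<lambda>q. f (u t q) q) (cinv c z) =
        coord_div (gram_det c) (\<lambda>i y. component c i (f (u t (cinv c y)) (cinv c y))) z"
      using divergence_coords[OF smooth_vector_field_along_graph[OF f uC[OF _ t]] c(1) chart(1)[OF zU]]
        chart(3)[OF zU] by simp
    moreover have "\<dots> = coord_div (gram_det c) (\<lambda>i y. field_coord c f i (v y, y)) z"
      by (rule coord_div_cong[OF B(1) z]) (simp add: field_coord_def v)
    moreover have "time_deriv u t (cinv c z) + divergence M A g (\<lambda>q. f (u t q) q) (cinv c z) = 0"
      using assms(5) t chart(2)[OF zU] by blast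
    ultimately show ?thesis by simp
  qed

  \<comment> \<open>At nonnegative times in \<open>I\<close> this is \<open>w r p\<close>. Elsewhere
    it is the continuation that provides a two-sided derivative at \<open>t\<close>.\<close>
  define F' where "F' = (\<lambda>r. D (\<lambda>y. F (r, y)) y x)"
  have F': "F' r = w r p" if "r \<in> I" "0 \<le> r" for r
  proof -
    have "D (\<lambda>y. F (r, y)) y = D (\<lambda>y. u r (cinv c y)) y"
      by (rule D_cong[OF B]) (simp add: Fu that)
    then show ?thesis
      using w[OF that(2) p] X_apply[OF u_near[OF that(2) p]] by (simp add: F'_def)
  qed
  have "time_deriv w t p = D F' t 1"
  proof (rule time_deriv_eq[OF I t])
    have "(\<lambda>r. D F (r, y) (0, x)) differentiable (at t)"
      unfolding real_differentiable_def
      by (rule exI, rule has_real_derivative_param[where G = "\<lambda>z. D F z (0, x)"],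
          rule Cinf_differentiable[OF Cinf_D[OF FC]]) (use I B in auto)
    moreover have "F' differentiable (at t) \<longleftrightarrow> (\<lambda>r. D F (r, y) (0, x)) differentiable (at t)"
      by (rule differentiable_cong_open[OF I]) (simp add: F'_def D_slice Fd B)
    ultimately show "(F' has_real_derivative D F' t 1) (at t)"
      using has_real_derivative_D by blast
  qed (simp add: F')
  moreover have "divergence M A g (\<lambda>q. tvec_scale (w t q) (param_deriv f (u t q) q)) p =
      coord_div (gram_det c) (\<lambda>i y. W y * ?fs i (v y, y)) y"
  proof -
    have "divergence M A g (\<lambda>q. tvec_scale (w t q) (param_deriv f (u t q) q)) p =
      coord_div (gram_det c) (\<lambda>i z. component c i
        (tvec_scale (w t (cinv c z)) (param_deriv f (u t (cinv c z)) (cinv c z)))) y"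
      unfolding y_def
      by (rule divergence_coords[OF smooth_vector_field_scaled_param_deriv[OF f uC[OF _ t] wC] c])
    also have "\<dots> = coord_div (gram_det c) (\<lambda>i y. W y * ?fs i (v y, y)) y"
      by (rule coord_div_cong[OF B])
        (use BU chart in \<open>auto simp: component_tvec_scale component_param_deriv[OF f c(1)] W_def v subset_iff\<close>)
    finally show ?thesis .
  qed
  moreover have "D F' t 1 + coord_div (gram_det c) (\<lambda>i y. W y * ?fs i (v y, y)) y =
    - (D (\<lambda>z. \<Sum>i\<in>UNIV. ?fs i (v y, z) * D v z (axis i 1)) y x
       - (\<Sum>i\<in>UNIV. ?fs i (v y, y) * D W y (axis i 1)))
    - D (coord_div (gram_det c) (\<lambda>i z. field_coord c f i (v y, z))) y x"
  proof (rule conservation_law_coords[OF I B FC _ _ _ v_def law _ _ F'_def])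
    show "Cinf (UNIV \<times> B) (field_coord c f i)" for i
      by (rule Cinf_subset[OF Cinf_field_coord[OF f c(1)]]) (use BU in \<open>auto simp: U_def\<close>)
    show "Cinf B (gram_det c)"
      by (rule Cinf_subset[OF Cinf_gram_det[OF c(1)]]) (use BU in \<open>auto simp: U_def\<close>)
    show "gram_det c z \<noteq> 0" if "z \<in> B" for z
      using gram_det_nonzero[OF c(1)] that BU by (auto simp: U_def)
    show "W differentiable (at y)"
      unfolding W_def using Cinf_differentiable[OF wC[OF c(1)]] U by (simp add: U_def)
    show "W y = D v y x"
      using F'[OF I(2) t] cinv_y by (simp add: W_def F'_def v_def)
  qed
  \<comment> \<open>The defining property of the gradient pairs it with tangent vectors. Since the
    bracket is one, the metric term becomes the bracket applied to \<open>u t\<close>.\<close>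
  moreover have "g p (grad M A g (u t) p) (lie_deriv M A X ?Y p) = X p (\<lambda>q. ?Y q (u t)) - ?Y p (\<lambda>q. X q (u t))"
    using metric_grad[OF p u_near[OF t p] lie_deriv_in_tangent_space[OF X Y p]] u_near[OF t p]
    by (simp add: lie_deriv_def)
  \<comment> \<open>The parameter of \<open>?Y\<close> stays at \<open>u t p\<close> while the point
    moves, hence \<open>v y\<close> and not \<open>v z\<close> in the components.\<close>
  moreover have "X p (\<lambda>q. ?Y q (u t)) = D (\<lambda>z. \<Sum>i\<in>UNIV. ?fs i (v y, z) * D v z (axis i 1)) y x"
  proof -
    have "X p (\<lambda>q. ?Y q (u t)) = D (\<lambda>y. ?Y (cinv c y) (u t)) y x"
      by (rule X_apply[OF smooth_near_vector_field_apply[OF Y p u_near[OF t p]]])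
    also have "\<dots> = D (\<lambda>z. \<Sum>i\<in>UNIV. ?fs i (v y, z) * D v z (axis i 1)) y x"
    proof (rule fun_cong[OF D_cong[OF B]])
      fix z assume z: "z \<in> B"
      then have zU: "z \<in> U" using BU by blast
      show "?Y (cinv c z) (u t) = (\<Sum>i\<in>UNIV. ?fs i (v y, z) * D v z (axis i 1))"
        using tangent_space_apply_sum[OF c(1) chart(1)[OF zU] smooth_vector_field_tangent[OF Y chart(2)[OF zU]]
            u_near[OF t chart(2)[OF zU]]]
        by (simp add: Yc[OF z] chart(3)[OF zU] Dv[OF z])
    qed
    finally show ?thesis .
  qed
  \<comment> \<open>Here the values of \<open>X\<close> around \<open>p\<close> matter: the function
    differentiated is \<open>W\<close>, not \<open>D v z x\<close>.\<close>
  moreover have "?Y p (\<lambda>q. X q (u t)) = (\<Sum>i\<in>UNIV. ?fs i (v y, y) * D W y (axis i 1))"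
  proof -
    have "D (\<lambda>y. X (cinv c y) (u t)) y = D W y"
      by (rule D_cong[OF U]) (simp add: W_def w[OF t] chart)
    then show ?thesis
      using tangent_space_apply_sum[OF c smooth_vector_field_tangent[OF Y p]
          smooth_near_vector_field_apply[OF X p u_near[OF t p]]] Yc[OF B(2)] cinv_y
      by (simp add: y_def)
  qed
  moreover have "X p (\<lambda>q. divergence M A g (f (u t p)) q) =
      D (coord_div (gram_det c) (\<lambda>i z. field_coord c f i (v y, z))) y x"
  proof -
    let ?d = "\<lambda>y. divergence M A g (f (u t p)) (cinv c y)"
    have V: "smooth_vector_field M A (f (u t p))" by (rule smooth_vector_field_fixed_param[OF f])
    have d: "?d z = coord_div (gram_det c) (\<lambda>i z. field_coord c f i (v y, z)) z" if "z \<in> U" for z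
      using divergence_coords[OF V c(1) chart(1)[OF that]] chart(3)[OF that]
      by (simp add: field_coord_def vy)
    \<comment> \<open>Smoothness of the divergence near \<open>p\<close> ensures that
      \<open>X p\<close> differentiates it instead of returning the default
      \<open>0\<close>.\<close>
    have "Cinf U (coord_div (gram_det c) (\<lambda>i z. field_coord c f i (v y, z)))"
    proof (rule Cinf_coord_div[OF U(1)])
      show "Cinf U (\<lambda>z. field_coord c f i (v y, z))" for i
        using smooth_vector_field_Cinf[OF V c(1)] by (simp add: field_coord_def U_def vy)
    qed (use Cinf_gram_det gram_det_nonzero c in \<open>auto simp: U_def\<close>)
    then have "Cinf U ?d" by (rule Cinf_cong[OF U(1), rotated]) (simp add: d)
    then have "smooth_near M A p (divergence M A g (f (u t p)))"
      by (intro smooth_near_cdomI[OF c]) (simp add: U_def)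
    from X_apply[OF this] show ?thesis
      using D_cong[OF U, of ?d, OF d] by simp
  qed
  ultimately show "time_deriv w t p
      + divergence M A g (\<lambda>q. tvec_scale (w t q) (param_deriv f (u t q) q)) p
    = - g p (grad M A g (u t) p) (lie_deriv M A X ?Y p) - X p (\<lambda>q. divergence M A g (f (u t p)) q)"
    by simp
qed

end
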